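(* Let $G$ be a homogeneous $m$-generic $L$-graph and let $\mathcal{A}$ be a $C_{ij}$-cover set contained in $O(G)$. Then for some distinct $k,l\in\{0,\dots,m-1\}\setminus\{i,j\}$ there is a $C_{ij}^{kl}$-omission set contained in $O(G)$ which is based on $\mathcal{A}$.
   Context: A language $L$ for coloured $m$-partite graphs specifies, for each pair of distinct $i,j\in\{0,\dots,m-1\}$, a finite nonempty set of colours $C_{ij}=C_{ji}$. An $L$-graph has vertex set partitioned into parts $V_0,\dots,V_{m-1}$ (no edges inside parts) with a colour $F(x,y)=F(y,x)\in C_{ij}$ for $x\in V_i,y\in V_j$, $i\ne j$. Substructures are induced subgraphs; embeddings are injective, part- and colour-preserving. $G$ is homogeneous if every isomorphism between finite induced subgraphs extends to an automorphism. $G$ is $m$-generic if every part is countably infinite and for all distinct $i,j$, finite $U\subseteq V_i$ and $f:U\to C_{ij}$ there is $x\in V_j$ with $F(x,u)=f(u)$ for all $u\in U$. A finite $L$-graph is realized in $G$ if it embeds in $G$, otherwise omitted; minimally omitted if omitted but all proper induced subgraphs are realized; $O(G)$ is the class of finite $L$-graphs minimally omitted from $G$. A monic is a finite $L$-graph with at most one vertex in each part; an $ijk$-triangle has exactly one vertex in each of $V_i,V_j,V_k$ and none elsewhere. For a monic $A$ with vertices in $V_i,V_j$, $F_A(E_{ij})$ is the colour of its $E_{ij}$-edge (the edge between them). A $C_{ij}$-cover set is a set of monics such that for each $c\in C_{ij}$ some member has $E_{ij}$-edge coloured $c$. For distinct $i,j,k,l$, a $C_{ij}^{kl}$-omission set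 is a $C_{ij}$-cover set of $ijk$-triangles and $ijl$-triangles with colours $c_{ik},c_{il},c_{jk},c_{jl}$ such that every $ijk$-triangle in it has $E_{ik},E_{jk}$-edges coloured $c_{ik},c_{jk}$ and every $ijl$-triangle in it has $E_{il},E_{jl}$-edges coloured $c_{il},c_{jl}$; its code is $(i,j,k,l;c_{ik},c_{il},c_{jk},c_{jl})$. It is based on a $C_{ij}$-cover set $\mathcal{A}$ if there are (not necessarily distinct) $A,A'\in\mathcal{A}$ with $A$ having vertices in $V_i,V_j,V_k$ and $F_A(E_{ik})=c_{ik}$, $F_A(E_{jk})=c_{jk}$, and $A'$ having vertices in $V_i,V_j,V_l$ and $F_{A'}(E_{il})=c_{il}$, $F_{A'}(E_{jl})=c_{jl}$. *)

theory Defs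
  imports Main "HOL-Library.Countable_Set"
begin

text \<open>
  A language for coloured \<open>m\<close>-partite graphs; \<open>colours L i j\<close> is the set \<open>C\<^sub>i\<^sub>j\<close>, which is
  meaningful only for distinct \<open>i, j < nparts L\<close>.
\<close>

record 'c language =
  nparts :: nat
  colours :: "nat \<Rightarrow> nat \<Rightarrow> 'c set"

definition is_language :: "'c language \<Rightarrow> bool" where
  "is_language L \<longleftrightarrow>
    (\<forall>i j. i < nparts L \<and> j < nparts L \<and> i \<noteq> j \<longrightarrow>
       finite (colours L i j) \<and> colours L i j \<noteq> {} \<and> colours L i j = colours L j i)"

text \<open>
  The values of \<open>part\<close> outside \<open>verts\<close>, and of \<open>col\<close> outside \<open>verts\<close> or on two vertices of the
  same part, carry no meaning: none of the notions below depends on them.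
\<close>

record ('v, 'c) lgraph =
  verts :: "'v set"
  part :: "'v \<Rightarrow> nat"
  col :: "'v \<Rightarrow> 'v \<Rightarrow> 'c"

definition is_lgraph :: "'c language \<Rightarrow> ('v, 'c) lgraph \<Rightarrow> bool" where
  "is_lgraph L G \<longleftrightarrow>
    (\<forall>x \<in> verts G. part G x < nparts L) \<and>
    (\<forall>x \<in> verts G. \<forall>y \<in> verts G. part G x \<noteq> part G y \<longrightarrow>
       col G x y = col G y x \<and> col G x y \<in> colours L (part G x) (part G y))"

definition part_set :: "('v, 'c) lgraph \<Rightarrow> nat \<Rightarrow> 'v set" where
  "part_set G i = {x \<in> verts G. part G x = i}"

definition induced :: "('v, 'c) lgraph \<Rightarrow> 'v set \<Rightarrow> ('v, 'c) lgraph" where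
  "induced G U = G\<lparr>verts := U\<rparr>"

definition embedding :: "('v, 'c) lgraph \<Rightarrow> ('w, 'c) lgraph \<Rightarrow> ('v \<Rightarrow> 'w) \<Rightarrow> bool" where
  "embedding G H f \<longleftrightarrow>
    inj_on f (verts G) \<and> f ` verts G \<subseteq> verts H \<and>
    (\<forall>x \<in> verts G. part H (f x) = part G x) \<and>
    (\<forall>x \<in> verts G. \<forall>y \<in> verts G. part G x \<noteq> part G y \<longrightarrow> col H (f x) (f y) = col G x y)"

definition isomorphism :: "('v, 'c) lgraph \<Rightarrow> ('w, 'c) lgraph \<Rightarrow> ('v \<Rightarrow> 'w) \<Rightarrow> bool" where
  "isomorphism G H f \<longleftrightarrow> embedding G H f \<and> f ` verts G = verts H"

definition automorphism :: "('v, 'c) lgraph \<Rightarrow> ('v \<Rightarrow> 'v) \<Rightarrow> bool" where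
  "automorphism G f \<longleftrightarrow> isomorphism G G f"

definition homogeneous :: "('v, 'c) lgraph \<Rightarrow> bool" where
  "homogeneous G \<longleftrightarrow>
    (\<forall>U W f. finite U \<and> U \<subseteq> verts G \<and> finite W \<and> W \<subseteq> verts G \<and>
       isomorphism (induced G U) (induced G W) f \<longrightarrow>
       (\<exists>g. automorphism G g \<and> (\<forall>x \<in> U. g x = f x)))"

definition generic :: "'c language \<Rightarrow> ('v, 'c) lgraph \<Rightarrow> bool" where
  "generic L G \<longleftrightarrow>
    (\<forall>i < nparts L. countable (part_set G i) \<and> infinite (part_set G i)) \<and>
    (\<forall>i < nparts L. \<forall>j < nparts L. i \<noteq> j \<longrightarrow>
       (\<forall>U f. finite U \<and> U \<subseteq> part_set G i \<and> f ` U \<subseteq> colours L i j \<longrightarrow>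
          (\<exists>x \<in> part_set G j. \<forall>u \<in> U. col G x u = f u)))"

definition realized :: "('v, 'c) lgraph \<Rightarrow> ('w, 'c) lgraph \<Rightarrow> bool" where
  "realized G H \<longleftrightarrow> (\<exists>f. embedding H G f)"

text \<open>
  The class \<open>O(G)\<close>, restricted to graphs whose vertices come from an arbitrary type \<open>'w\<close>,
  unrelated to the vertex type of \<open>G\<close>.
\<close>

definition min_omitted :: "'c language \<Rightarrow> ('v, 'c) lgraph \<Rightarrow> ('w, 'c) lgraph set" where
  "min_omitted L G =
    {H. is_lgraph L H \<and> finite (verts H) \<and> \<not> realized G H \<and>
        (\<forall>U. U \<subset> verts H \<longrightarrow> realized G (induced H U))}"

definition monic :: "'c language \<Rightarrow> ('w, 'c) lgraph \<Rightarrow> bool" where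
  "monic L A \<longleftrightarrow>
    is_lgraph L A \<and> finite (verts A) \<and>
    (\<forall>i. \<forall>x \<in> part_set A i. \<forall>y \<in> part_set A i. x = y)"

definition has_parts :: "('w, 'c) lgraph \<Rightarrow> nat set \<Rightarrow> bool" where
  "has_parts A I \<longleftrightarrow> (\<forall>i \<in> I. part_set A i \<noteq> {})"

definition triangle :: "'c language \<Rightarrow> nat \<Rightarrow> nat \<Rightarrow> nat \<Rightarrow> ('w, 'c) lgraph \<Rightarrow> bool" where
  "triangle L i j k A \<longleftrightarrow>
    is_lgraph L A \<and>
    (\<forall>p \<in> {i, j, k}. \<exists>!x. x \<in> part_set A p) \<and>
    (\<forall>p. p \<notin> {i, j, k} \<longrightarrow> part_set A p = {})"

text \<open>
  \<open>F\<^sub>A(E\<^sub>i\<^sub>j)\<close>: only meaningful for a monic \<open>A\<close> with vertices in both the parts \<open>i \<noteq> j\<close>, so every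
  use below is accompanied by a condition guaranteeing those vertices.
\<close>

definition edge_col :: "('w, 'c) lgraph \<Rightarrow> nat \<Rightarrow> nat \<Rightarrow> 'c" where
  "edge_col A i j = col A (THE x. x \<in> part_set A i) (THE y. y \<in> part_set A j)"

definition cover_set :: "'c language \<Rightarrow> nat \<Rightarrow> nat \<Rightarrow> ('w, 'c) lgraph set \<Rightarrow> bool" where
  "cover_set L i j \<A> \<longleftrightarrow>
    (\<forall>A \<in> \<A>. monic L A) \<and>
    (\<forall>c \<in> colours L i j. \<exists>A \<in> \<A>. has_parts A {i, j} \<and> edge_col A i j = c)"

text \<open>
  The code is an explicit argument: a set of triangles need not determine all four of its colours.
\<close>

datatype 'c code = Code nat nat nat nat
  'c 'c 'c 'c

fun omission_set :: "'c language \<Rightarrow> 'c code \<Rightarrow> ('w, 'c) lgraph set \<Rightarrow> bool" where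
  "omission_set L (Code i j k l cik cil cjk cjl) S \<longleftrightarrow>
    distinct [i, j, k, l] \<and> {i, j, k, l} \<subseteq> {..<nparts L} \<and>
    cik \<in> colours L i k \<and> cil \<in> colours L i l \<and> cjk \<in> colours L j k \<and> cjl \<in> colours L j l \<and>
    cover_set L i j S \<and>
    (\<forall>A \<in> S. triangle L i j k A \<or> triangle L i j l A) \<and>
    (\<forall>A \<in> S. triangle L i j k A \<longrightarrow> edge_col A i k = cik \<and> edge_col A j k = cjk) \<and>
    (\<forall>A \<in> S. triangle L i j l A \<longrightarrow> edge_col A i l = cil \<and> edge_col A j l = cjl)"

fun code_based_on :: "'c code \<Rightarrow> ('w, 'c) lgraph set \<Rightarrow> bool" where
  "code_based_on (Code i j k l cik cil cjk cjl) \<A> \<longleftrightarrow>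
    (\<exists>A \<in> \<A>. has_parts A {i, j, k} \<and> edge_col A i k = cik \<and> edge_col A j k = cjk) \<and>
    (\<exists>A' \<in> \<A>. has_parts A' {i, j, l} \<and> edge_col A' i l = cil \<and> edge_col A' j l = cjl)"

end

theory Submission
  imports Defs
begin

text \<open>
  Suppose that no omission set as required exists. Write \<open>A\<^sub>e\<close> for a member of the cover set whose
  \<open>E\<^sub>i\<^sub>j\<close>-edge \<open>xy\<close> has colour \<open>e\<close>, and let \<open>M\<close> be the disjoint union of all \<open>A\<^sub>e - {x, y}\<close>. If the
  colours between different blocks of \<open>M\<close> can be chosen so that both \<open>M \<union> {x}\<close> and \<open>M \<union> {y}\<close> are
  realized, then amalgamating them gives \<open>xy\<close> some colour \<open>e\<close>, and \<open>A\<^sub>e\<close> is realized, a contradiction.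

  The absence of omission sets says exactly that all 4-cycles \<open>x m y n\<close> with \<open>m\<close>, \<open>n\<close> in different
  blocks can be completed. Adding vertices and edges one at a time, it remains to complete a 4-cycle
  \<open>x z y v\<close> over a set \<open>R\<close> when its four sides are realized over \<open>R\<close> and the bare cycle can be
  completed; by induction this reduces to adding one hub \<open>u\<close> to the 4-cycle. The wheel is completed by
  repeated amalgamation, using that \<open>G\<close> has no algebraicity. Hence amalgamation is strong, only
  monics are minimally omitted, and several copies of a vertex with different colours can be
  amalgamated simultaneously.
\<close>

section \<open>Types over finite sets are infinite\<close>

lemma homogeneousE:
  assumes "homogeneous G" "finite U" "U \<subseteq> verts G" "f ` U \<subseteq> verts G" "inj_on f U"
    and "\<And>x. x \<in> U \<Longrightarrow> part G (f x) = part G x"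
    and "\<And>x y. x \<in> U \<Longrightarrow> y \<in> U \<Longrightarrow> part G x \<noteq> part G y \<Longrightarrow> col G (f x) (f y) = col G x y"
  obtains g where "automorphism G g" "\<And>x. x \<in> U \<Longrightarrow> g x = f x"
proof -
  have "isomorphism (induced G U) (induced G (f ` U)) f"
    using assms by (auto simp: isomorphism_def embedding_def induced_def)
  then show ?thesis
    using assms that unfolding homogeneous_def by (metis finite_imageI)
qed

lemma automorphismD:
  assumes "automorphism G g"
  shows "x \<in> verts G \<Longrightarrow> g x \<in> verts G"
    and "x \<in> verts G \<Longrightarrow> part G (g x) = part G x"
    and "x \<in> verts G \<Longrightarrow> y \<in> verts G \<Longrightarrow> g x = g y \<longleftrightarrow> x = y"
    and "x \<in> verts G \<Longrightarrow> y \<in> verts G \<Longrightarrow> part G x \<noteq> part G y \<Longrightarrow> col G (g x) (g y) = col G x y"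
  using assms unfolding automorphism_def isomorphism_def embedding_def inj_on_def by auto

text \<open>Colours to vertices of \<open>B\<close> in the part of \<open>a\<close> carry no meaning
  and are ignored, so the set may meet \<open>B\<close>. That it is infinite for finite
  \<open>B\<close> expresses that \<open>G\<close> has no algebraicity.\<close>

definition type_over :: "('v, 'c) lgraph \<Rightarrow> 'v set \<Rightarrow> 'v \<Rightarrow> 'v set" where
  "type_over G B a = {x \<in> verts G. part G x = part G a \<and>
     (\<forall>b \<in> B. part G b \<noteq> part G a \<longrightarrow> col G x b = col G a b)}"

locale generic_homogeneous =
  fixes L :: "'c language" and G :: "('v, 'c) lgraph"
  assumes lgraph: "is_lgraph L G" and homogeneous: "homogeneous G" and generic: "generic L G"
begin

text \<open>All of \<open>Y\<close> lies in one part, so there are no edges inside \<open>Y\<close>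
  or inside its image. Preserving the colours to \<open>B\<close> therefore makes \<phi>, extended
  by the identity on \<open>B\<close>, a finite partial isomorphism.\<close>

lemma automorphism_moving:
  assumes "finite B" "B \<subseteq> verts G" "finite Y" "Y \<subseteq> part_set G p - B" "\<phi> ` Y \<subseteq> part_set G p - B"
    and "inj_on \<phi> Y"
    and cols: "\<And>y d. y \<in> Y \<Longrightarrow> d \<in> B \<Longrightarrow> part G d \<noteq> p \<Longrightarrow> col G (\<phi> y) d = col G y d"
  obtains g where "automorphism G g" "\<And>d. d \<in> B \<Longrightarrow> g d = d" "\<And>y. y \<in> Y \<Longrightarrow> g y = \<phi> y"
proof -
  define f where "f x = (if x \<in> Y then \<phi> x else x)" for x
  have Y: "y \<in> verts G" "part G y = p" "y \<notin> B" "\<phi> y \<in> verts G" "part G (\<phi> y) = p" "\<phi> y \<notin> B"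
    if "y \<in> Y" for y using assms(4,5) that unfolding part_set_def by auto
  have sym: "col G x y = col G y x" if "x \<in> verts G" "y \<in> verts G" "part G x \<noteq> part G y" for x y
    using lgraph that unfolding is_lgraph_def by blast
  have sub: "f ` (B \<union> Y) \<subseteq> verts G"
    using assms(2) Y(4) unfolding f_def by auto
  have inj: "inj_on f (B \<union> Y)"
    using Y(6) assms(6) unfolding f_def inj_on_def by (metis Un_iff)
  have pf: "part G (f x) = part G x" for x
    using Y(2,5) unfolding f_def by simp
  have cf: "col G (f x) (f y) = col G x y" if xy: "x \<in> B \<union> Y" "y \<in> B \<union> Y" "part G x \<noteq> part G y" for x y
  proof -
    have 1: "col G (f x) (f y) = col G x y" if "x \<in> Y" "y \<in> B" "part G x \<noteq> part G y" for x y
      using cols[OF that(1,2)] that Y[OF that(1)] Y(3)[of y] unfolding f_def by auto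
    have "f x = x" if "x \<in> B" for x using that Y(3) unfolding f_def by auto
    then have 2: "col G (f y) (f x) = col G y x" if "x \<in> Y" "y \<in> B" "part G x \<noteq> part G y" for x y
      using 1[OF that] sym[of x y] sym[of "f x" "f y"] that Y[OF that(1)] assms(2) pf
      unfolding f_def by auto
    consider "x \<in> Y" "y \<in> Y" | "x \<in> Y" "y \<in> B" | "x \<in> B" "y \<in> Y" | "x \<in> B" "y \<in> B" "x \<notin> Y" "y \<notin> Y"
      using xy(1,2) by blast
    then show ?thesis
    proof cases
      case 1
      then show ?thesis using xy(3) Y(2) by simp
    qed (use 1 2 xy(3) in \<open>auto simp: f_def\<close>)
  qed
  obtain g where g: "automorphism G g" "\<And>x. x \<in> B \<union> Y \<Longrightarrow> g x = f x"
    using homogeneousE[OF homogeneous _ _ sub inj pf cf] assms(1-3) Y(1) by blast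
  have "g d = d" if "d \<in> B" for d using g(2)[of d] that Y(3) unfolding f_def by auto
  moreover have "g y = \<phi> y" if "y \<in> Y" for y using g(2)[of y] that unfolding f_def by auto
  ultimately show ?thesis using g(1) that by blast
qed

text \<open>
  Let \<open>a\<close> have a finite type over \<open>B\<close> with \<open>B\<close> as small as possible, remove \<open>b\<close> from \<open>B\<close>, and let \<open>S\<close> and
  \<open>N\<close> be the now infinite types of \<open>a\<close> and \<open>b\<close> over the rest. The finite sets \<open>T y\<close>, for \<open>y \<in> N\<close>, of
  vertices in \<open>S\<close> joined to \<open>y\<close> as \<open>a\<close> is to \<open>b\<close> intersect pairwise in the same way, which forces them
  to be disjoint. So \<open>a\<close> determines \<open>b\<close>, and the colour of \<open>b\<close> to any other vertex depends only on the
  type of that vertex over \<open>B - {b}\<close>; genericity excludes this.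
\<close>

lemma infinite_type_over:
  assumes "a \<in> verts G" "finite B" "B \<subseteq> verts G"
  shows "infinite (type_over G B a)"
  using assms
proof (induction "card B" arbitrary: a B rule: less_induct)
  case less
  note IH = less.hyps and a = less.prems(1) and B = less.prems(2,3)
  show ?case
  proof (cases "\<exists>b\<in>B. part G b = part G a")
    case True
    then obtain b where b: "b \<in> B" "part G b = part G a" by blast
    have "type_over G B a = type_over G (B - {b}) a"
      using b unfolding type_over_def by auto
    moreover have "card (B - {b}) < card B"
      using b B by (meson card_Diff1_less)
    ultimately show ?thesis using IH[of "B - {b}" a] a B by auto
  next
    case False
    show ?thesis
    proof (cases "B = {}")
      case True
      have "type_over G B a = part_set G (part G a)"
        using True by (auto simp: type_over_def part_set_def)
      then show ?thesis
        using generic lgraph a unfolding generic_def is_lgraph_def by auto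
    next
      case nonempty: False
      then obtain b where b: "b \<in> B" by blast
      define B' where "B' = B - {b}"
      define S where "S = type_over G B' a"
      \<comment> \<open>\<open>B'\<close> is removed because it may contain vertices in the part of
        \<open>b\<close>. No vertex of \<open>B\<close> lies in the part of \<open>a\<close>, so
        \<open>S\<close> avoids \<open>B'\<close> by itself.\<close>
      define N where "N = type_over G B' b - B'"
      define c where "c = col G a b"
      define T where "T y = {x \<in> S. col G x y = c}" for y
      have B': "finite B'" "B' \<subseteq> verts G" "b \<notin> B'"
        using b B unfolding B'_def by auto
      have "card B' < card B"
        using b B(1) unfolding B'_def by (meson card_Diff1_less)
      note B' = B'(1,2) this B'(3)
      have pB': "part G d \<noteq> part G a" if "d \<in> B'" for d
        using False that unfolding B'_def by auto
      have pb: "part G b \<noteq> part G a" and bG: "b \<in> verts G"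
        using False b B by auto
      have Sinf: "infinite S" unfolding S_def using IH B' a by blast
      have Ninf: "infinite N" unfolding N_def using IH B' bG by (meson finite_Diff2)
      have aS: "a \<in> S" and bN: "b \<in> N"
        using a bG B' unfolding S_def N_def type_over_def by auto
      have S: "x \<in> verts G" "part G x = part G a" "x \<notin> B'" if "x \<in> S" for x
        using that pB' unfolding S_def type_over_def by auto
      have N: "y \<in> verts G" "part G y = part G b" "y \<notin> B'" if "y \<in> N" for y
        using that unfolding N_def type_over_def by auto
      have Scol: "col G x d = col G a d" if "x \<in> S" "d \<in> B'" for x d
        using that pB' unfolding S_def type_over_def by auto
      have Ncol: "col G x d = col G b d" if "x \<in> N" "d \<in> B'" "part G d \<noteq> part G b" for x d
        using that unfolding N_def type_over_def by auto
      have sym: "col G x y = col G y x" if "x \<in> verts G" "y \<in> verts G" "part G x \<noteq> part G y" for x y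
        using lgraph that unfolding is_lgraph_def by blast
      have TB: "T b = type_over G B a"
        using b pb unfolding T_def S_def type_over_def B'_def c_def by auto
      define fixes_base where "fixes_base g \<longleftrightarrow> automorphism G g \<and> (\<forall>d\<in>B'. g d = d)" for g
      have fixS: "g x \<in> S" if g: "fixes_base g" and x: "x \<in> S" for g x
      proof -
        have "col G (g x) d = col G a d" if d: "d \<in> B'" for d
          using automorphismD(4)[of G g x d] g S[OF x] d pB'[OF d] B'(2) Scol[OF x d]
          unfolding fixes_base_def by auto
        then show ?thesis
          using automorphismD(1,2)[of G g x] g S[OF x]
          unfolding fixes_base_def S_def type_over_def by simp
      qed
      have fixN: "g x \<in> N" if g: "fixes_base g" and x: "x \<in> N" for g x
      proof -
        have "col G (g x) d = col G b d" if d: "d \<in> B'" "part G d \<noteq> part G b" for d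
          using automorphismD(4)[of G g x d] g N[OF x] d B'(2) Ncol[OF x d]
          unfolding fixes_base_def by auto
        moreover have "g x \<notin> B'"
        proof
          assume d: "g x \<in> B'"
          then have "g (g x) = g x" "g x \<in> verts G" using g B' unfolding fixes_base_def by auto
          then have "g x = x" using automorphismD(3)[of G g "g x" x] g N[OF x] unfolding fixes_base_def by simp
          then show False using d N[OF x] by simp
        qed
        ultimately show ?thesis
          using automorphismD(1,2)[of G g x] g N[OF x]
          unfolding fixes_base_def N_def type_over_def by simp
      qed
      have fixcol: "col G (g x) (g y) = col G x y" if "fixes_base g" "x \<in> verts G" "y \<in> verts G"
          "part G x \<noteq> part G y" for g x y
        using that automorphismD(4)[of G g x y] unfolding fixes_base_def by simp
      have moveN: "\<exists>g. fixes_base g \<and> (\<forall>y\<in>Y. g y = \<phi> y)"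
        if Y: "finite Y" "Y \<subseteq> N" "\<phi> ` Y \<subseteq> N" "inj_on \<phi> Y" for Y \<phi>
      proof -
        have "Y \<subseteq> part_set G (part G b) - B'" "\<phi> ` Y \<subseteq> part_set G (part G b) - B'"
          using Y N unfolding part_set_def by blast+
        moreover have "col G (\<phi> y) d = col G y d" if "y \<in> Y" "d \<in> B'" "part G d \<noteq> part G b" for y d
        proof -
          have "y \<in> N" "\<phi> y \<in> N" using Y that by auto
          then show ?thesis using Ncol that by simp
        qed
        ultimately show ?thesis
          using automorphism_moving[OF B'(1,2) Y(1) _ _ Y(4)] unfolding fixes_base_def by metis
      qed
      have moveS: "\<exists>g. fixes_base g \<and> (\<forall>y\<in>Y. g y = \<phi> y)"
        if Y: "finite Y" "Y \<subseteq> part_set G (part G a)" "\<phi> ` Y \<subseteq> part_set G (part G a)" "inj_on \<phi> Y"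
          and tp: "\<And>y d. y \<in> Y \<Longrightarrow> d \<in> B' \<Longrightarrow> col G (\<phi> y) d = col G y d" for Y \<phi>
      proof -
        have "part_set G (part G a) \<inter> B' = {}"
          using pB' unfolding part_set_def by auto
        then have "Y \<subseteq> part_set G (part G a) - B'" "\<phi> ` Y \<subseteq> part_set G (part G a) - B'"
          using Y by auto
        then show ?thesis
          using automorphism_moving[OF B'(1,2) Y(1) _ _ Y(4)] tp unfolding fixes_base_def by metis
      qed
      have fixSN: "col G (g x) (g y) = col G x y" if "fixes_base g" "x \<in> S" "y \<in> N" for g x y
        using fixcol[OF that(1) S(1)[OF that(2)] N(1)[OF that(3)]] S(2)[OF that(2)] N(2)[OF that(3)] pb by simp
      show ?thesis
      proof
        assume "finite (type_over G B a)"
        then have Tfin: "finite (T b)" using TB by simp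
        \<comment> \<open>Pigeonhole: the finite set \<open>T b\<close> has finitely many subsets,
          so two of the infinitely many \<open>y\<close> meet it in the same subset.\<close>
        have "finite ((\<lambda>y. T b \<inter> T y) ` (N - {b}))"
          using Tfin by (auto intro: finite_subset[of _ "Pow (T b)"])
        moreover have "infinite (N - {b})" using Ninf by simp
        ultimately have "\<not> inj_on (\<lambda>y. T b \<inter> T y) (N - {b})"
          using finite_imageD by blast
        then obtain y1 y2 where y12: "y1 \<in> N - {b}" "y2 \<in> N - {b}" "y1 \<noteq> y2"
          and T12: "T b \<inter> T y1 = T b \<inter> T y2"
          unfolding inj_on_def by blast
        \<comment> \<open>An automorphism fixing \<open>B'\<close> and \<open>b\<close> carries
          \<open>y\<close>, \<open>y'\<close> to \<open>y1\<close>, \<open>y2\<close>, so the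
          coincidence \<open>T12\<close> holds for every such pair.\<close>
        have same: "x \<in> T y'" if x: "x \<in> T b" "x \<in> T y" and y: "y \<in> N - {b}" "y' \<in> N - {b}" for x y y'
        proof (cases "y = y'")
          case ne: False
          define \<phi> where "\<phi> z = (if z = b then b else if z = y then y1 else y2)" for z
          have "\<exists>g. fixes_base g \<and> (\<forall>z\<in>{b,y,y'}. g z = \<phi> z)"
          proof (rule moveN)
            show "{b,y,y'} \<subseteq> N" "\<phi> ` {b,y,y'} \<subseteq> N" using y y12 bN unfolding \<phi>_def by auto
            show "inj_on \<phi> {b,y,y'}" using y y12(1-3) ne unfolding \<phi>_def inj_on_def by auto
          qed simp
          then obtain g where g: "fixes_base g" "g b = b" "g y = y1" "g y' = y2"
            using y ne unfolding \<phi>_def by auto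
          have xS: "x \<in> S" and cx: "col G x b = c" "col G x y = c" using x unfolding T_def by auto
          have yN: "y \<in> N" "y' \<in> N" using y by auto
          have "g x \<in> T b" "g x \<in> T y1"
            using fixSN[OF g(1) xS bN] fixSN[OF g(1) xS yN(1)] cx fixS[OF g(1) xS]
            unfolding T_def g by auto
          then have "g x \<in> T y2" using T12 by blast
          then show ?thesis
            using fixSN[OF g(1) xS yN(2)] xS unfolding T_def g by simp
        qed (use x in simp)
        \<comment> \<open>Such an \<open>x\<close> has colour \<open>c\<close> to all of
          \<open>N\<close>. Automorphisms fixing \<open>B'\<close> are transitive on
          \<open>S\<close> and preserve \<open>N\<close>, so the infinite set \<open>S\<close> would
          lie inside the finite \<open>T b\<close>.\<close>
        have disj_b: False if x: "x \<in> T b" "x \<in> T y" and y: "y \<in> N" "y \<noteq> b" for x y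
        proof -
          have all: "col G x y' = c" if "y' \<in> N" for y'
            using same[OF x, of y'] x y that unfolding T_def by (cases "y' = b") auto
          have xS: "x \<in> S" using x unfolding T_def by auto
          have "x' \<in> T b" if x': "x' \<in> S" for x'
          proof -
            have "\<exists>g. fixes_base g \<and> (\<forall>z\<in>{x'}. g z = x)"
              using moveS[of "{x'}" "\<lambda>_. x"] S[OF x'] S[OF xS] Scol[OF x'] Scol[OF xS]
              by (auto simp: part_set_def)
            then obtain g where g: "fixes_base g" "g x' = x" by auto
            have "col G x' b = col G x (g b)" using fixSN[OF g(1) x' bN] g by simp
            then show ?thesis using all[OF fixN[OF g(1) bN]] x' unfolding T_def by simp
          qed
          then have "S \<subseteq> T b" by blast
          then show False using Sinf Tfin finite_subset by blast
        qed
        have disj: False if x: "x \<in> T y" "x \<in> T y'" and y: "y \<in> N" "y' \<in> N" "y \<noteq> y'" for x y y'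
        proof -
          have "\<exists>g. fixes_base g \<and> (\<forall>z\<in>{y}. g z = b)"
            using moveN[of "{y}" "\<lambda>_. b"] y bN by auto
          then obtain g where g: "fixes_base g" "g y = b" by auto
          have xS: "x \<in> S" using x unfolding T_def by auto
          have "g x \<in> T b" "g x \<in> T (g y')"
            using fixSN[OF g(1) xS y(1)] fixSN[OF g(1) xS y(2)] g(2) x fixS[OF g(1) xS]
            unfolding T_def by simp_all
          moreover have "g y' \<noteq> b"
            using automorphismD(3)[OF _ N(1)[OF y(2)] N(1)[OF y(1)], of g] g y(3)
            unfolding fixes_base_def by auto
          ultimately show False using disj_b fixN[OF g(1) y(2)] by blast
        qed
        obtain b2 where b2: "b2 \<in> N" "b2 \<noteq> b"
          using y12 by auto
        obtain b3 where b3: "b3 \<in> N" "b3 \<noteq> b" "b3 \<noteq> b2"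
        proof -
          have "infinite (N - {b, b2})" using Ninf by simp
          then have "N - {b, b2} \<noteq> {}" by (metis finite.emptyI)
          then show ?thesis using that by blast
        qed
        have "\<exists>g. fixes_base g \<and> (\<forall>z\<in>{b}. g z = b2)"
          using moveN[of "{b}" "\<lambda>_. b2"] b2 bN by auto
        then obtain g where g: "fixes_base g" "g b = b2" by auto
        define a2 where "a2 = g a"
        have a2S: "a2 \<in> S" unfolding a2_def using fixS[OF g(1) aS] .
        have aT: "a \<in> T b" using aS unfolding T_def c_def by simp
        have a2T: "a2 \<in> T b2"
          using fixSN[OF g(1) aS bN] a2S g unfolding T_def a2_def c_def by simp
        \<comment> \<open>By disjointness \<open>a\<close> is not in \<open>T b2\<close>, so a
          second colour between the two parts is available.\<close>
        define c' where "c' = col G a b2"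
        have c': "c' \<noteq> c" using disj[OF aT, of b2] b2 bN aS unfolding T_def c'_def by auto
        have cc: "c \<in> colours L (part G b) (part G a)" "c' \<in> colours L (part G b) (part G a)"
        proof -
          have "col G a y \<in> colours L (part G b) (part G a)" if "y \<in> N" for y
          proof -
            have "col G y a \<in> colours L (part G y) (part G a)"
              using lgraph a N[OF that] pb unfolding is_lgraph_def by metis
            then show ?thesis using sym[OF a N(1)[OF that]] N(2)[OF that] pb by simp
          qed
          then show "c \<in> colours L (part G b) (part G a)" "c' \<in> colours L (part G b) (part G a)"
            using bN b2(1) unfolding c_def c'_def by auto
        qed
        \<comment> \<open>A vertex \<open>w\<close> is sought with colour \<open>c'\<close> to
          \<open>b\<close> and \<open>c\<close> to \<open>b2\<close>, \<open>b3\<close>. The colour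
          to \<open>b\<close> separates \<open>w\<close> from \<open>a\<close>; the one to
          \<open>b3\<close> separates it from \<open>a2\<close>, since \<open>T b2\<close> and
          \<open>T b3\<close> are disjoint.\<close>
        define \<phi> where "\<phi> y = (if y = b then c' else c)" for y
        have "{b,b2,b3} \<subseteq> part_set G (part G b)" "\<phi> ` {b,b2,b3} \<subseteq> colours L (part G b) (part G a)"
          using N(1,2)[OF bN] N(1,2)[OF b2(1)] N(1,2)[OF b3(1)] cc
          unfolding part_set_def \<phi>_def by auto
        then have U: "finite {b,b2,b3} \<and> {b,b2,b3} \<subseteq> part_set G (part G b) \<and>
            \<phi> ` {b,b2,b3} \<subseteq> colours L (part G b) (part G a)" by blast
        have "part G b < nparts L" "part G a < nparts L"
          using lgraph a bG unfolding is_lgraph_def by auto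
        then have "finite U \<and> U \<subseteq> part_set G (part G b) \<and> f ` U \<subseteq> colours L (part G b) (part G a) \<longrightarrow>
            (\<exists>x\<in>part_set G (part G a). \<forall>u\<in>U. col G x u = f u)" for U f
          using generic pb unfolding generic_def by simp
        from mp[OF this U] obtain w where w: "w \<in> part_set G (part G a)" "\<forall>y\<in>{b,b2,b3}. col G w y = \<phi> y" ..
        have wc: "col G w b = c'" "col G w b2 = c" "col G w b3 = c"
          using w b2 b3 unfolding \<phi>_def by auto
        have wG: "w \<in> verts G" "part G w = part G a" using w unfolding part_set_def by auto
        have wa: "w \<noteq> a" using wc c' unfolding c_def by auto
        have wa2: "w \<noteq> a2"
          using disj[OF a2T, of b3] b2 b3 a2S wc unfolding T_def by auto
        \<comment> \<open>\<open>w'\<close> has the type of \<open>w\<close> over \<open>B'\<close>,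
          so some automorphism fixes \<open>B'\<close> and \<open>a2\<close> and moves
          \<open>w\<close> to \<open>w'\<close>. It must fix \<open>b2\<close>, the only vertex of
          \<open>N\<close> with colour \<open>c\<close> to \<open>a2\<close>, although
          \<open>w\<close> and \<open>w'\<close> have the different colours \<open>c\<close> and
          \<open>c'\<close> to \<open>b2\<close>.\<close>
        define w' where "w' = g w"
        have gaut: "automorphism G g" using g unfolding fixes_base_def by simp
        have w'G: "w' \<in> verts G" "part G w' = part G a"
          using automorphismD(1,2)[OF gaut wG(1)] wG unfolding w'_def by simp_all
        have w'a2: "w' \<noteq> a2"
          using automorphismD(3)[OF gaut wG(1) a] wa unfolding w'_def a2_def by simp
        have w'c: "col G w' b2 = c'"
          using fixcol[OF g(1) wG(1) bG] wG(2) pb wc(1) g(2) unfolding w'_def by simp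
        have w'd: "col G w' d = col G w d" if "d \<in> B'" for d
        proof -
          have "d \<in> verts G" "part G w \<noteq> part G d" "g d = d"
            using that B' pB'[OF that] wG g unfolding fixes_base_def by auto
          then show ?thesis using fixcol[OF g(1) wG(1), of d] unfolding w'_def by simp
        qed
        define \<psi> where "\<psi> z = (if z = a2 then a2 else w')" for z
        have "\<exists>g. fixes_base g \<and> (\<forall>z\<in>{a2,w}. g z = \<psi> z)"
        proof (rule moveS)
          show "inj_on \<psi> {a2,w}" using w'a2 unfolding \<psi>_def inj_on_def by auto
          show "{a2,w} \<subseteq> part_set G (part G a)" "\<psi> ` {a2,w} \<subseteq> part_set G (part G a)"
            using S[OF a2S] wG w'G unfolding \<psi>_def part_set_def by auto
          show "col G (\<psi> y) d = col G y d" if "y \<in> {a2,w}" "d \<in> B'" for y d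
            using that w'd[of d] unfolding \<psi>_def by auto
        qed simp
        then obtain g' where g': "fixes_base g'" "g' a2 = a2" "g' w = w'"
          using wa2 unfolding \<psi>_def by auto
        have "col G a2 (g' b2) = c"
          using fixSN[OF g'(1) a2S b2(1)] g' a2T unfolding T_def by simp
        then have "a2 \<in> T (g' b2)" using a2S unfolding T_def by simp
        then have "g' b2 = b2" using disj[OF a2T _ b2(1) fixN[OF g'(1) b2(1)]] by fastforce
        then have "col G w' b2 = col G w b2"
          using fixcol[OF g'(1) wG(1) N(1)[OF b2(1)]] N(2)[OF b2(1)] wG(2) pb g'(3) by simp
        then show False using w'c wc(2) c' by simp
      qed
    qed
  qed
qed

end

section \<open>Realized finite graphs and amalgamation\<close>

text \<open>Part map, vertex set and colouring are separate arguments, so that edges can be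
  recoloured and vertices dropped while the rest stays fixed.\<close>

definition realizes :: "('v, 'c) lgraph \<Rightarrow> ('w \<Rightarrow> nat) \<Rightarrow> 'w set \<Rightarrow> ('w \<Rightarrow> 'w \<Rightarrow> 'c) \<Rightarrow> bool" where
  "realizes G p W c \<longleftrightarrow> realized G \<lparr>verts = W, part = p, col = c\<rparr>"

definition recolour :: "('w \<Rightarrow> 'w \<Rightarrow> 'c) \<Rightarrow> 'w \<Rightarrow> 'w \<Rightarrow> 'c \<Rightarrow> 'w \<Rightarrow> 'w \<Rightarrow> 'c" where
  "recolour c a b e x y = (if {x, y} = {a, b} then e else c x y)"

lemma realizes_iff:
  "realizes G p W c \<longleftrightarrow> (\<exists>f. inj_on f W \<and> (\<forall>x\<in>W. f x \<in> verts G \<and> part G (f x) = p x) \<and>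
     (\<forall>x\<in>W. \<forall>y\<in>W. p x \<noteq> p y \<longrightarrow> col G (f x) (f y) = c x y))"
  unfolding realizes_def realized_def embedding_def by (auto simp: image_subset_iff)

lemma realized_induced: "realized G (induced A U) \<longleftrightarrow> realizes G (part A) U (col A)"
  unfolding realizes_def induced_def by (cases A) simp

lemma realizes_pullback:
  assumes "realizes G p W c" "inj_on \<phi> V" "\<phi> ` V \<subseteq> W"
    and "\<And>x. x \<in> V \<Longrightarrow> p (\<phi> x) = q x"
    and "\<And>x y. x \<in> V \<Longrightarrow> y \<in> V \<Longrightarrow> q x \<noteq> q y \<Longrightarrow> c (\<phi> x) (\<phi> y) = d x y"
  shows "realizes G q V d"
proof -
  obtain f where f: "inj_on f W" "\<And>x. x \<in> W \<Longrightarrow> f x \<in> verts G \<and> part G (f x) = p x"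
    "\<And>x y. x \<in> W \<Longrightarrow> y \<in> W \<Longrightarrow> p x \<noteq> p y \<Longrightarrow> col G (f x) (f y) = c x y"
    using assms(1) unfolding realizes_iff by blast
  have "inj_on (f \<circ> \<phi>) V"
    using f(1) assms(2,3) by (meson comp_inj_on inj_on_subset)
  moreover have \<phi>: "\<phi> x \<in> W" if "x \<in> V" for x using that assms(3) by blast
  moreover have "col G (f (\<phi> x)) (f (\<phi> y)) = d x y" if "x \<in> V" "y \<in> V" "q x \<noteq> q y" for x y
    using f(3)[OF \<phi>[OF that(1)] \<phi>[OF that(2)]] assms(4)[OF that(1)] assms(4)[OF that(2)]
      assms(5)[OF that] that(3) by simp
  ultimately show ?thesis
    unfolding realizes_iff using f(2) assms(4) by (intro exI[of _ "f \<circ> \<phi>"]) auto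
qed

lemma realizes_cong:
  assumes "realizes G p W c" "V \<subseteq> W"
    and "\<And>x y. x \<in> V \<Longrightarrow> y \<in> V \<Longrightarrow> p x \<noteq> p y \<Longrightarrow> c x y = d x y"
  shows "realizes G p V d"
  using realizes_pullback[OF assms(1), of "\<lambda>x. x" V p d] assms(2,3) by auto

lemma realizes_subset: "realizes G p W c \<Longrightarrow> V \<subseteq> W \<Longrightarrow> realizes G p V c"
  using realizes_cong by blast

context generic_homogeneous
begin

text \<open>An automorphism moves one image of \<open>W\<close> onto the other. Types over finite
  sets being infinite, the image of \<open>b\<close> can be replaced by a vertex of the same type
  that differs from the image of \<open>a\<close>; the colour of this pair in \<open>G\<close> is
  \<open>e\<close>.\<close>

lemma realizes_amalgam:
  assumes W: "finite W" and ab: "a \<notin> W" "b \<notin> W" "a \<noteq> b"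
    and ra: "realizes G p (insert a W) c" and rb: "realizes G p (insert b W) c"
  obtains e where "realizes G p (insert a (insert b W)) (recolour c a b e)"
proof -
  have sym: "col G x y = col G y x" if "x \<in> verts G" "y \<in> verts G" "part G x \<noteq> part G y" for x y
    using lgraph that unfolding is_lgraph_def by blast
  obtain f where f: "inj_on f (insert a W)" "\<And>x. x \<in> insert a W \<Longrightarrow> f x \<in> verts G \<and> part G (f x) = p x"
    "\<And>x y. x \<in> insert a W \<Longrightarrow> y \<in> insert a W \<Longrightarrow> p x \<noteq> p y \<Longrightarrow> col G (f x) (f y) = c x y"
    using ra unfolding realizes_iff by blast
  obtain g where g: "inj_on g (insert b W)" "\<And>x. x \<in> insert b W \<Longrightarrow> g x \<in> verts G \<and> part G (g x) = p x"
    "\<And>x y. x \<in> insert b W \<Longrightarrow> y \<in> insert b W \<Longrightarrow> p x \<noteq> p y \<Longrightarrow> col G (g x) (g y) = c x y"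
    using rb unfolding realizes_iff by blast
  define h where "h = g \<circ> inv_into W f"
  have fW: "inj_on f W" and gW: "inj_on g W" using f g by (auto intro: inj_on_subset)
  have h: "h (f x) = g x" if "x \<in> W" for x
    using fW that unfolding h_def by simp
  have "inj_on h (f ` W)"
    using gW h unfolding inj_on_def by (metis imageE)
  moreover have "h ` f ` W \<subseteq> verts G" "f ` W \<subseteq> verts G" using h g(2) f(2) by auto
  moreover have "part G (h x) = part G x" if "x \<in> f ` W" for x
    using that h f(2) g(2) by auto
  moreover have "col G (h x) (h y) = col G x y" if "x \<in> f ` W" "y \<in> f ` W" "part G x \<noteq> part G y" for x y
    using that h f(2,3) g(2,3) by auto
  ultimately obtain \<theta> where \<theta>: "automorphism G \<theta>" "\<And>x. x \<in> f ` W \<Longrightarrow> \<theta> x = h x"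
    using homogeneousE[OF homogeneous, of "f ` W" h] W by (metis finite_imageI)
  define \<alpha> where "\<alpha> = \<theta> (f a)"
  have fa: "f a \<in> verts G" "part G (f a) = p a" using f(2) by auto
  have \<alpha>: "\<alpha> \<in> verts G" "part G \<alpha> = p a"
    using automorphismD(1,2)[OF \<theta>(1) fa(1)] fa(2) unfolding \<alpha>_def by auto
  have \<theta>f: "\<theta> (f x) = g x" if "x \<in> W" for x using \<theta>(2) h that by simp
  have \<alpha>n: "\<alpha> \<notin> g ` W"
  proof
    assume "\<alpha> \<in> g ` W"
    then obtain x where x: "x \<in> W" "\<theta> (f a) = \<theta> (f x)" using \<theta>f unfolding \<alpha>_def by auto
    then have "f a = f x" using automorphismD(3)[OF \<theta>(1) fa(1), of "f x"] f(2)[of x] by simp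
    then show False using f(1) x(1) ab(1) unfolding inj_on_def by blast
  qed
  have \<alpha>c: "col G \<alpha> (g x) = c a x" "col G (g x) \<alpha> = c x a" if "x \<in> W" "p x \<noteq> p a" for x
  proof -
    have fx: "f x \<in> verts G" "part G (f x) \<noteq> part G (f a)" using f(2) that fa by auto
    show "col G \<alpha> (g x) = c a x" "col G (g x) \<alpha> = c x a"
      using automorphismD(4)[OF \<theta>(1) fa(1) fx(1)] automorphismD(4)[OF \<theta>(1) fx(1) fa(1)] fx(2)
        \<theta>f[OF that(1)] f(3)[of a x] f(3)[of x a] that
      unfolding \<alpha>_def by auto
  qed
  obtain \<beta> where \<beta>: "\<beta> \<in> type_over G (g ` W) (g b)" "\<beta> \<notin> g ` W" "\<beta> \<noteq> \<alpha>"
  proof -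
    have "infinite (type_over G (g ` W) (g b))"
      using infinite_type_over[of "g b" "g ` W"] g(2) W by auto
    then have "infinite (type_over G (g ` W) (g b) - insert \<alpha> (g ` W))" using W by simp
    then have "type_over G (g ` W) (g b) - insert \<alpha> (g ` W) \<noteq> {}" by (metis finite.emptyI)
    then show ?thesis using that by blast
  qed
  have gb: "g b \<in> verts G" "part G (g b) = p b" using g(2) by auto
  have \<beta>G: "\<beta> \<in> verts G" "part G \<beta> = p b" using \<beta>(1) gb unfolding type_over_def by auto
  have \<beta>c: "col G \<beta> (g x) = c b x" "col G (g x) \<beta> = c x b" if "x \<in> W" "p x \<noteq> p b" for x
  proof -
    have gx: "g x \<in> verts G" "part G (g x) = p x" using g(2) that by auto
    show 1: "col G \<beta> (g x) = c b x"
      using \<beta>(1) that gx gb g(3)[of b x] unfolding type_over_def by auto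
    have "c x b = c b x" using g(3)[of b x] g(3)[of x b] sym[OF gx(1) gb(1)] gx gb that by auto
    then show "col G (g x) \<beta> = c x b" using 1 sym[OF gx(1) \<beta>G(1)] gx \<beta>G that by auto
  qed
  define k where "k x = (if x = a then \<alpha> else if x = b then \<beta> else g x)" for x
  have kW: "k x = g x" if "x \<in> W" for x using that ab unfolding k_def by auto
  have "inj_on k (insert a (insert b W))"
    using gW \<alpha>n \<beta>(2,3) ab kW unfolding inj_on_def k_def by auto
  moreover have "\<forall>x\<in>insert a (insert b W). k x \<in> verts G \<and> part G (k x) = p x"
    using \<alpha> \<beta>G g(2) kW ab unfolding k_def by auto
  moreover have "\<forall>x\<in>insert a (insert b W). \<forall>y\<in>insert a (insert b W). p x \<noteq> p y \<longrightarrow>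
     col G (k x) (k y) = recolour c a b (col G \<alpha> \<beta>) x y"
  proof (intro ballI impI)
    fix x y assume xy: "x \<in> insert a (insert b W)" "y \<in> insert a (insert b W)" "p x \<noteq> p y"
    then consider "x \<in> W" "y \<in> W" | "x = a" "y = b" | "x = b" "y = a" | "x = a" "y \<in> W" | "x = b" "y \<in> W"
      | "x \<in> W" "y = a" | "x \<in> W" "y = b" by auto
    then show "col G (k x) (k y) = recolour c a b (col G \<alpha> \<beta>) x y"
    proof cases
      case 1
      then show ?thesis using kW g(3)[of x y] xy(3) ab unfolding recolour_def doubleton_eq_iff by auto
    next
      case 2
      then show ?thesis using ab unfolding k_def recolour_def doubleton_eq_iff by auto
    next
      case 3
      then show ?thesis using ab sym[OF \<alpha>(1) \<beta>G(1)] \<alpha>(2) \<beta>G(2) xy(3) unfolding k_def recolour_def doubleton_eq_iff by auto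
    qed (use kW \<alpha>c \<beta>c xy(3) ab in \<open>auto simp: recolour_def doubleton_eq_iff k_def\<close>)
  qed
  ultimately have "realizes G p (insert a (insert b W)) (recolour c a b (col G \<alpha> \<beta>))"
    unfolding realizes_iff by blast
  then show ?thesis by (rule that)
qed

text \<open>The colour of two vertices in the same part has no meaning, so amalgamating them over
  the rest realizes \<open>W\<close> itself. By induction only sets without such pairs
  remain.\<close>

lemma realizes_if_monics:
  assumes "finite W"
    and "\<And>M. M \<subseteq> W \<Longrightarrow> inj_on p M \<Longrightarrow> realizes G p M c"
  shows "realizes G p W c"
  using assms
proof (induction "card W" arbitrary: W rule: less_induct)
  case less
  show ?case
  proof (cases "inj_on p W")
    case False
    then obtain a b where ab: "a \<in> W" "b \<in> W" "a \<noteq> b" "p a = p b" unfolding inj_on_def by blast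
    define V where "V = W - {a, b}"
    have V: "insert a V = W - {b}" "insert b V = W - {a}" "insert a (insert b V) = W"
      using ab unfolding V_def by auto
    have "realizes G p (W - {x}) c" if "x \<in> W" for x
      using less.hyps[of "W - {x}"] less.prems that by (metis Diff_subset card_Diff1_less finite_Diff subset_trans)
    then have "realizes G p (insert a V) c" "realizes G p (insert b V) c" using V ab by auto
    then obtain e where "realizes G p W (recolour c a b e)"
      using realizes_amalgam[of V a b p c] less.prems(1) ab(3) V unfolding V_def by fastforce
    then show ?thesis
      by (rule realizes_cong) (use ab(4) in \<open>auto simp: recolour_def doubleton_eq_iff\<close>)
  qed (use less in auto)
qed

text \<open>
  Vertices are pairs \<open>(x, i)\<close>, two copies of each \<open>x\<close>; a section \<open>s\<close> picks one copy of each. Since a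
  monic uses at most one of the two copies, a graph is realized as soon as all its sections are, and
  so one colour of the pair \<open>a\<close>, \<open>b\<close> serves all sections simultaneously.
\<close>

lemma realizes_amalgam_sections:
  fixes C :: "'w \<times> bool \<Rightarrow> 'w \<times> bool \<Rightarrow> 'c"
  assumes W: "finite W" and ab: "a \<notin> W" "b \<notin> W" "a \<noteq> b"
    and "\<And>s. s a = False \<Longrightarrow> realizes G p (insert a W) (\<lambda>x y. C (x, s x) (y, s y))"
    and "\<And>s. s b = False \<Longrightarrow> realizes G p (insert b W) (\<lambda>x y. C (x, s x) (y, s y))"
  obtains e where "\<And>s. s a = False \<Longrightarrow> s b = False \<Longrightarrow>
    realizes G p (insert a (insert b W)) (recolour (\<lambda>x y. C (x, s x) (y, s y)) a b e)"
proof -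
  \<comment> \<open>Of \<open>a\<close> and \<open>b\<close> only the copy \<open>False\<close> is
    included, so the ordinary amalgamation leaves a single pair to be coloured.\<close>
  have one: "realizes G (p \<circ> fst) (insert (d, False) (W \<times> UNIV)) C"
    if d: "d \<notin> W" and r: "\<And>s. s d = False \<Longrightarrow> realizes G p (insert d W) (\<lambda>x y. C (x, s x) (y, s y))" for d
  proof (rule realizes_if_monics)
    fix M assume M: "M \<subseteq> insert (d, False) (W \<times> UNIV)" and inj: "inj_on (p \<circ> fst) M"
    define s where "s x \<longleftrightarrow> (x, True) \<in> M" for x
    have s: "snd z = s (fst z)" if z: "z \<in> M" for z
    proof (cases "snd z")
      case True
      then show ?thesis using that unfolding s_def by (metis prod.collapse)
    next
      case False
      have "(fst z, True) \<notin> M"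
      proof
        assume "(fst z, True) \<in> M"
        then have "z = (fst z, True)" using inj_onD[OF inj, of z "(fst z, True)"] z by simp
        then show False using False by (metis snd_conv)
      qed
      then show ?thesis using False unfolding s_def by simp
    qed
    have "s d = False" using M d unfolding s_def by auto
    from r[of s, OF this] show "realizes G (p \<circ> fst) M C"
    proof (rule realizes_pullback)
      show "inj_on fst M" using inj by (rule inj_on_imageI2)
      show "fst ` M \<subseteq> insert d W" using M by auto
      show "C (fst x, s (fst x)) (fst y, s (fst y)) = C x y" if "x \<in> M" "y \<in> M" for x y
        unfolding s[OF that(1), symmetric] s[OF that(2), symmetric] by simp
    qed simp
  qed (use W in auto)
  obtain e where e: "realizes G (p \<circ> fst) (insert (a, False) (insert (b, False) (W \<times> UNIV)))
      (recolour C (a, False) (b, False) e)"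
    using realizes_amalgam[OF _ _ _ _ one[OF ab(1) assms(5)] one[OF ab(2) assms(6)]] W ab by auto
  have "realizes G p (insert a (insert b W)) (recolour (\<lambda>x y. C (x, s x) (y, s y)) a b e)"
    if "s a = False" "s b = False" for s
    by (rule realizes_pullback[OF e, of "\<lambda>x. (x, s x)"])
      (use that in \<open>auto simp: inj_on_def recolour_def doubleton_eq_iff\<close>)
  then show ?thesis by (rule that)
qed

text \<open>The case where only \<open>d1\<close> and \<open>d2\<close> are doubled, with copies
  indexed by \<open>i\<close> and \<open>j\<close>; by \<open>c1\<close> and \<open>c2\<close>,
  changing a copy affects only the pairs at that vertex. A family constant in one index amounts to a
  single doubled vertex.\<close>

lemma realizes_amalgam_copies:
  fixes c :: "bool \<Rightarrow> bool \<Rightarrow> 'w \<Rightarrow> 'w \<Rightarrow> 'c"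
  assumes W: "finite W" and ab: "a \<notin> W" "b \<notin> W" "a \<noteq> b" and d: "d1 \<in> W" "d2 \<in> W" "d1 \<noteq> d2"
    and c1: "\<And>i j x y. x \<noteq> d1 \<Longrightarrow> y \<noteq> d1 \<Longrightarrow> c i j x y = c False j x y"
    and c2: "\<And>i j x y. x \<noteq> d2 \<Longrightarrow> y \<noteq> d2 \<Longrightarrow> c i j x y = c i False x y"
    and ra: "\<And>i j. realizes G p (insert a W) (c i j)"
    and rb: "\<And>i j. realizes G p (insert b W) (c i j)"
  obtains e where "\<And>i j. realizes G p (insert a (insert b W)) (recolour (c i j) a b e)"
proof -
  \<comment> \<open>The copy index of \<open>d\<close> is read off from the pair. If
    \<open>d\<close> is not in the pair, the default \<open>False\<close> is harmless by
    \<open>c1\<close> and \<open>c2\<close>.\<close>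
  define sel where "sel d u v \<longleftrightarrow> (if fst u = d then snd u else if fst v = d then snd v else False)"
    for d :: 'w and u v :: "'w \<times> bool"
  define C where "C u v = c (sel d1 u v) (sel d2 u v) (fst u) (fst v)" for u v
  have C: "(\<lambda>x y. C (x, s x) (y, s y)) = c (s d1) (s d2)" for s
  proof (intro ext)
    fix x y
    show "C (x, s x) (y, s y) = c (s d1) (s d2) x y"
      using c1[of x y "s d1" "s d2"] c1[of x y "s d1" False] c2[of x y "s d1" "s d2"]
      unfolding C_def sel_def by auto
  qed
  obtain e where e: "\<And>s. s a = False \<Longrightarrow> s b = False \<Longrightarrow>
    realizes G p (insert a (insert b W)) (recolour (\<lambda>x y. C (x, s x) (y, s y)) a b e)"
    using realizes_amalgam_sections[OF W ab, of p C] ra rb unfolding C by blast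
  have "realizes G p (insert a (insert b W)) (recolour (c i j) a b e)" for i j
  proof -
    have "a \<noteq> d1" "a \<noteq> d2" "b \<noteq> d1" "b \<noteq> d2" using ab d by auto
    then show ?thesis
      using e[of "\<lambda>x. if x = d1 then i else if x = d2 then j else False"] d(3) unfolding C by simp
  qed
  then show ?thesis by (rule that)
qed

end

section \<open>Completing wheels and 4-cycles\<close>

lemma recolour_commute: "recolour c a b e = recolour c b a e"
  unfolding recolour_def by (simp add: insert_commute)

lemma recolour_same:
  assumes "\<And>x y. c x y = c y x"
  shows "recolour c a b (c a b) = c"
  using assms unfolding recolour_def by (intro ext) (auto simp: doubleton_eq_iff)

text \<open>
  A wheel with hub \<open>u\<close> and rim \<open>x\<close>, \<open>z\<close>, \<open>y\<close>, \<open>v\<close>, over a set \<open>R\<close> of further vertices. \<open>F\<close> lists the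
  colours of the spokes \<open>ux\<close>, \<open>uz\<close>, \<open>uy\<close>, \<open>uv\<close> and of the diagonals \<open>xy\<close>, \<open>zv\<close>.
\<close>

locale wheel = generic_homogeneous L G for L :: "'c language" and G :: "('v, 'c) lgraph" +
  fixes p :: "'w \<Rightarrow> nat" and R :: "'w set" and c :: "'w \<Rightarrow> 'w \<Rightarrow> 'c" and u x z y v :: 'w
  assumes R: "finite R" and dist: "distinct [u, x, z, y, v]" and R_dist: "{u, x, z, y, v} \<inter> R = {}"
    and c_sym: "\<And>a b. c a b = c b a"
begin

definition F where "F l f k e h g =
  recolour (recolour (recolour (recolour (recolour (recolour c u x l) u z f) u y k) u v e) x y h) z v g"

definition P where "P S d \<longleftrightarrow> realizes G p (S \<union> R) d"

lemma distinct_vertices: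
  "u \<noteq> x" "u \<noteq> z" "u \<noteq> y" "u \<noteq> v" "x \<noteq> z" "x \<noteq> y" "x \<noteq> v" "z \<noteq> y" "z \<noteq> v" "y \<noteq> v"
  "u \<notin> R" "x \<notin> R" "z \<notin> R" "y \<notin> R" "v \<notin> R"
  using dist R_dist by auto

lemmas vertex_neq = distinct_vertices distinct_vertices(1-10)[symmetric]

lemma distinct_pairs:
  "{u, x} \<noteq> {u, z}" "{u, x} \<noteq> {u, y}" "{u, x} \<noteq> {u, v}" "{u, x} \<noteq> {x, y}" "{u, x} \<noteq> {z, v}"
  "{u, z} \<noteq> {u, y}" "{u, z} \<noteq> {u, v}" "{u, z} \<noteq> {x, y}" "{u, z} \<noteq> {z, v}"
  "{u, y} \<noteq> {u, v}" "{u, y} \<noteq> {x, y}" "{u, y} \<noteq> {z, v}"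
  "{u, v} \<noteq> {x, y}" "{u, v} \<noteq> {z, v}" "{x, y} \<noteq> {z, v}"
  using vertex_neq by (simp_all add: doubleton_eq_iff)

lemma F_simps:
  "recolour (F l f k e h g) u x l' = F l' f k e h g"
  "recolour (F l f k e h g) u z f' = F l f' k e h g"
  "recolour (F l f k e h g) u y k' = F l f k' e h g"
  "recolour (F l f k e h g) u v e' = F l f k e' h g"
  "recolour (F l f k e h g) x y h' = F l f k e h' g"
  "recolour (F l f k e h g) z v g' = F l f k e h g'"
  using distinct_pairs unfolding F_def recolour_def by (intro ext; simp)+

lemma F_self: "F (c u x) (c u z) (c u y) (c u v) (c x y) (c z v) = c"
  unfolding F_def by (simp add: recolour_same[of c, OF c_sym])

lemma F_agree:
  assumes "l \<noteq> l' \<Longrightarrow> {s, t} \<noteq> {u, x}" "f \<noteq> f' \<Longrightarrow> {s, t} \<noteq> {u, z}" "k \<noteq> k' \<Longrightarrow> {s, t} \<noteq> {u, y}"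
    "e \<noteq> e' \<Longrightarrow> {s, t} \<noteq> {u, v}" "h \<noteq> h' \<Longrightarrow> {s, t} \<noteq> {x, y}" "g \<noteq> g' \<Longrightarrow> {s, t} \<noteq> {z, v}"
  shows "F l f k e h g s t = F l' f' k' e' h' g' s t"
proof -
  have "recolour d a b e1 s t = recolour d' a b e2 s t"
    if "d s t = d' s t" "e1 \<noteq> e2 \<Longrightarrow> {s, t} \<noteq> {a, b}" for d d' a b e1 e2
    using that unfolding recolour_def by auto
  note step = this
  show ?thesis unfolding F_def by (intro step assms refl)
qed

text \<open>The wheel vertices lie outside \<open>R\<close>, so a spoke or diagonal can matter on
  \<open>S' \<union> R\<close> only if both its ends are in \<open>S'\<close>.\<close>

lemma P_transfer:
  assumes "P S (F l f k e h g)" "S' \<subseteq> S"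
    and "u \<in> S' \<Longrightarrow> x \<in> S' \<Longrightarrow> l' = l" "u \<in> S' \<Longrightarrow> z \<in> S' \<Longrightarrow> f' = f"
    and "u \<in> S' \<Longrightarrow> y \<in> S' \<Longrightarrow> k' = k" "u \<in> S' \<Longrightarrow> v \<in> S' \<Longrightarrow> e' = e"
    and "x \<in> S' \<Longrightarrow> y \<in> S' \<Longrightarrow> h' = h" "z \<in> S' \<Longrightarrow> v \<in> S' \<Longrightarrow> g' = g"
  shows "P S' (F l' f' k' e' h' g')"
  using assms(1) unfolding P_def
proof (rule realizes_cong)
  show "F l f k e h g a b = F l' f' k' e' h' g' a b" if "a \<in> S' \<union> R" "b \<in> S' \<union> R" for a b
  proof (rule F_agree)
    have *: "s \<in> S' \<and> t \<in> S'" if "{a, b} = {s, t}" "s \<notin> R" "t \<notin> R" for s t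
      using that \<open>a \<in> S' \<union> R\<close> \<open>b \<in> S' \<union> R\<close> by (auto simp: doubleton_eq_iff)
    show "{a, b} \<noteq> {u, x}" if "l \<noteq> l'" using *[of u x] that assms(3) vertex_neq by metis
    show "{a, b} \<noteq> {u, z}" if "f \<noteq> f'" using *[of u z] that assms(4) vertex_neq by metis
    show "{a, b} \<noteq> {u, y}" if "k \<noteq> k'" using *[of u y] that assms(5) vertex_neq by metis
    show "{a, b} \<noteq> {u, v}" if "e \<noteq> e'" using *[of u v] that assms(6) vertex_neq by metis
    show "{a, b} \<noteq> {x, y}" if "h \<noteq> h'" using *[of x y] that assms(7) vertex_neq by metis
    show "{a, b} \<noteq> {z, v}" if "g \<noteq> g'" using *[of z v] that assms(8) vertex_neq by metis
  qed
qed (use assms(2) in auto)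

lemma P_amalgam:
  assumes "P (insert a S) d" "P (insert b S) d" "finite S" "a \<notin> S" "b \<notin> S" "a \<notin> R" "b \<notin> R" "a \<noteq> b"
  obtains e where "P (insert a (insert b S)) (recolour d a b e)"
  using realizes_amalgam[of "S \<union> R" a b p d] assms R unfolding P_def by auto

lemma P_amalgam_copies:
  fixes d :: "bool \<Rightarrow> bool \<Rightarrow> 'w \<Rightarrow> 'w \<Rightarrow> 'c"
  assumes "d1 \<in> S" "d2 \<in> S" "d1 \<noteq> d2"
    and "\<And>i j. P (insert a S) (d i j)" "\<And>i j. P (insert b S) (d i j)"
    and "\<And>i j s t. s \<noteq> d1 \<Longrightarrow> t \<noteq> d1 \<Longrightarrow> d i j s t = d False j s t"
    and "\<And>i j s t. s \<noteq> d2 \<Longrightarrow> t \<noteq> d2 \<Longrightarrow> d i j s t = d i False s t"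
    and "finite S" "a \<notin> S" "b \<notin> S" "a \<notin> R" "b \<notin> R" "a \<noteq> b"
  shows "\<exists>e. \<forall>i j. P (insert a (insert b S)) (recolour (d i j) a b e)"
proof (rule realizes_amalgam_copies[where W = "S \<union> R" and a = a and b = b and p = p])
  show "realizes G p (insert a (S \<union> R)) (d i j)" "realizes G p (insert b (S \<union> R)) (d i j)" for i j
    using assms(4,5) unfolding P_def by simp_all
  show ?thesis if "\<And>i j. realizes G p (insert a (insert b (S \<union> R))) (recolour (d i j) a b e)" for e
    using that unfolding P_def by auto
  show "d i j s t = d False j s t" if "s \<noteq> d1" "t \<noteq> d1" for i j s t using assms(6)[OF that] .
  show "d i j s t = d i False s t" if "s \<noteq> d2" "t \<noteq> d2" for i j s t using assms(7)[OF that] .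
qed (use assms(1-3,8-) R in auto)

text \<open>
  Choose auxiliary colours \<open>k1\<close> of \<open>uy\<close> and \<open>l1\<close> of \<open>ux\<close> for which all four combinations of old and new
  spokes are unproblematic. Amalgamating \<open>z\<close>, \<open>v\<close> over two copies of \<open>u\<close>, one with \<open>k1\<close> and one with \<open>l1\<close>,
  gives a colour of \<open>zv\<close> that suits the original spokes \<open>ux\<close> and \<open>uy\<close> separately, and \<open>x\<close>, \<open>y\<close> are
  amalgamated last.
\<close>

lemma wheel_weak:
  assumes "P {u, x, z} c" "P {u, z, y} c" "P {u, y, v} c" "P {u, v, x} c" "P {x, y, z} c" "P {x, y, v} c"
  obtains e h g where "P {u, x, z, y, v} (recolour (recolour (recolour c u v e) x y h) z v g)"
proof -
  define l f k e h g where lfk: "l = c u x" "f = c u z" "k = c u y" "e = c u v" "h = c x y" "g = c z v"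
  have cF: "F l f k e h g = c" unfolding lfk F_self ..
  have A: "P {u, x, z} (F l f k e h g)" "P {u, z, y} (F l f k e h g)" "P {u, y, v} (F l f k e h g)"
    "P {u, v, x} (F l f k e h g)" "P {x, y, z} (F l f k e h g)" "P {x, y, v} (F l f k e h g)"
    unfolding cF by (rule assms)+
  obtain h' where 0: "P {x, y, u, v} (F l f k e h' g)"
  proof (rule P_amalgam[of x "{u, v}" "F l f k e h g" y])
    show "P {x, u, v} (F l f k e h g)"
      by (rule P_transfer[OF A(4)]; simp add: vertex_neq)
    show "P {y, u, v} (F l f k e h g)"
      by (rule P_transfer[OF A(3)]; simp add: vertex_neq)
  qed (use that in \<open>simp_all add: vertex_neq F_simps\<close>)
  obtain k1 where 1: "P {u, y, x, z} (F l f k1 e h g)"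
  proof (rule P_amalgam[of u "{x, z}" "F l f k e h g" y])
    show "P {u, x, z} (F l f k e h g)"
      by (rule P_transfer[OF A(1)]; simp add: vertex_neq)
    show "P {y, x, z} (F l f k e h g)"
      by (rule P_transfer[OF A(5)]; simp add: vertex_neq)
  qed (use that in \<open>simp_all add: vertex_neq F_simps\<close>)
  \<comment> \<open>Here \<open>i\<close> selects the copy of \<open>y\<close>, and \<open>j\<close>
    has no effect. Together with \<open>1\<close> this realizes the spokes \<open>(l, k1)\<close>,
    \<open>(l1, k)\<close> and \<open>(l1, k1)\<close> with \<open>xy\<close> coloured
    \<open>h\<close>.\<close>
  obtain l1 where 2: "\<And>i. P {u, x, y, z} (F l1 f (if i then k1 else k) e h g)"
  proof -
    let ?d = "\<lambda>(i::bool) (j::bool). F l f (if i then k1 else k) e h g"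
    have a: "P (insert u {y, z}) (?d i j)" "P (insert x {y, z}) (?d i j)" for i j
      by (cases i; simp only: if_True if_False; ((rule P_transfer[OF A(2)]; (simp add: vertex_neq; fail)) | (rule P_transfer[OF 1]; (simp add: vertex_neq; fail)) | (rule P_transfer[OF A(5)]; (simp add: vertex_neq; fail))))+
    have b: "?d i j s t = ?d False j s t" if "s \<noteq> y" "t \<noteq> y" for i j s t
      by (rule F_agree) (use that in \<open>auto simp: vertex_neq doubleton_eq_iff split: if_splits\<close>)
    have c: "?d i j s t = ?d i False s t" if "s \<noteq> z" "t \<noteq> z" for i j s t
      by (rule F_agree) (use that in \<open>auto simp: vertex_neq doubleton_eq_iff split: if_splits\<close>)
    have "\<exists>e. \<forall>i j. P (insert u (insert x {y, z})) (recolour (?d i j) u x e)"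
      by (rule P_amalgam_copies[where d = ?d and ?d1.0 = y and ?d2.0 = z, OF _ _ _ a b c]) (simp_all add: vertex_neq)
    then show ?thesis using that unfolding F_simps by blast
  qed
  \<comment> \<open>Now \<open>i\<close> selects the copy of \<open>x\<close> and \<open>j\<close>
    that of \<open>y\<close>. All four combinations have to be realized over \<open>x\<close>,
    \<open>y\<close>; the one with both spokes old takes its colour \<open>h'\<close> of
    \<open>xy\<close> from \<open>0\<close>.\<close>
  obtain e1 where 3: "\<And>i j. P {u, v, x, y} (F (if i then l1 else l) f (if j then k else k1) e1
      (if \<not> i \<and> j then h' else h) g)"
  proof -
    let ?d = "\<lambda>(i::bool) (j::bool). F (if i then l1 else l) f (if j then k else k1) e
      (if \<not> i \<and> j then h' else h) g"
    have a: "P (insert u {x, y}) (?d i j)" "P (insert v {x, y}) (?d i j)" for i j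
      by (cases i; cases j; simp only: if_True if_False simp_thms;
        ((rule P_transfer[OF 0]; (simp add: vertex_neq; fail)) | (rule P_transfer[OF 1]; (simp add: vertex_neq; fail)) | (rule P_transfer[OF 2[of True]]; (simp add: vertex_neq; fail)) | (rule P_transfer[OF 2[of False]]; (simp add: vertex_neq; fail)) | (rule P_transfer[OF A(6)]; (simp add: vertex_neq; fail))))+
    have b: "?d i j s t = ?d False j s t" if "s \<noteq> x" "t \<noteq> x" for i j s t
      by (rule F_agree) (use that in \<open>auto simp: vertex_neq doubleton_eq_iff split: if_splits\<close>)
    have c: "?d i j s t = ?d i False s t" if "s \<noteq> y" "t \<noteq> y" for i j s t
      by (rule F_agree) (use that in \<open>auto simp: vertex_neq doubleton_eq_iff split: if_splits\<close>)
    have "\<exists>e. \<forall>i j. P (insert u (insert v {x, y})) (recolour (?d i j) u v e)"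
      by (rule P_amalgam_copies[where d = ?d and ?d1.0 = x and ?d2.0 = y, OF _ _ _ a b c]) (simp_all add: vertex_neq)
    then show ?thesis using that unfolding F_simps by blast
  qed
  obtain g1 where 4: "\<And>i. P {z, v, u, x, y} (F (if i then l1 else l) f (if i then k else k1) e1 h g1)"
  proof -
    let ?d = "\<lambda>(i::bool) (j::bool). F (if i then l1 else l) f (if i then k else k1) e1 h g"
    have a: "P (insert z {u, x, y}) (?d i j)" "P (insert v {u, x, y}) (?d i j)" for i j
      by (cases i; simp only: if_True if_False simp_thms;
        ((rule P_transfer[OF 1]; (simp add: vertex_neq; fail)) | (rule P_transfer[OF 2[of False]]; (simp add: vertex_neq; fail)) | (rule P_transfer[OF 3[of False False, simplified]]; (simp add: vertex_neq; fail)) | (rule P_transfer[OF 3[of True True, simplified]]; (simp add: vertex_neq; fail))))+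
    have b: "?d i j s t = ?d False j s t" if "s \<noteq> u" "t \<noteq> u" for i j s t
      by (rule F_agree) (use that in \<open>auto simp: vertex_neq doubleton_eq_iff split: if_splits\<close>)
    have c: "?d i j s t = ?d i False s t" if "s \<noteq> x" "t \<noteq> x" for i j s t
      by (rule F_agree) (use that in \<open>auto simp: vertex_neq doubleton_eq_iff split: if_splits\<close>)
    have "\<exists>e. \<forall>i j. P (insert z (insert v {u, x, y})) (recolour (?d i j) z v e)"
      by (rule P_amalgam_copies[where d = ?d and ?d1.0 = u and ?d2.0 = x, OF _ _ _ a b c]) (simp_all add: vertex_neq)
    then show ?thesis using that unfolding F_simps by blast
  qed
  \<comment> \<open>Each side sees only its own spoke: \<open>x\<close> uses the copy of
    \<open>u\<close> with the old \<open>l\<close>, and \<open>y\<close> the copy with the old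
    \<open>k\<close>.\<close>
  obtain h1 where 5: "P {x, y, u, z, v} (F l f k e1 h1 g1)"
  proof (rule P_amalgam[of x "{u, z, v}" "F l f k e1 h g1" y])
    show "P {x, u, z, v} (F l f k e1 h g1)"
      by (rule P_transfer[OF 4[of False]]; simp add: vertex_neq)
    show "P {y, u, z, v} (F l f k e1 h g1)"
      by (rule P_transfer[OF 4[of True]]; simp add: vertex_neq)
  qed (use that in \<open>simp_all add: vertex_neq F_simps\<close>)
  have "recolour (recolour (recolour (F l f k e h g) u v e1) x y h1) z v g1 = F l f k e1 h1 g1"
    by (simp only: F_simps)
  then show ?thesis
    using 5 that[of e1 h1 g1] unfolding cF by (simp add: insert_commute)
qed

text \<open>
  The weak completion may recolour the spoke \<open>uv\<close>, or symmetrically \<open>uz\<close>. Give both completions the same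
  colour of \<open>zv\<close> and amalgamate \<open>x\<close>, \<open>y\<close> over the two copies of \<open>u\<close>: the resulting colour of \<open>xy\<close> suits
  the original spokes \<open>uz\<close> and \<open>uv\<close>.
\<close>

lemma wheel_realized:
  assumes "P {u, x, z} c" "P {u, z, y} c" "P {u, y, v} c" "P {u, v, x} c" "P {x, y, z} c" "P {x, y, v} c"
  obtains h g where "P {u, x, z, y, v} (recolour (recolour c x y h) z v g)"
proof -
  define l f k e h g where lfk: "l = c u x" "f = c u z" "k = c u y" "e = c u v" "h = c x y" "g = c z v"
  have cF: "F l f k e h g = c" unfolding lfk F_self ..
  interpret swapped: wheel L G p R c u x v y z
    using R dist R_dist c_sym by unfold_locales auto
  have *: "P {u, v, y} c" "P {u, x, v} c" "P {u, y, z} c" "P {u, z, x} c"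
    using assms by (simp_all add: insert_commute)
  obtain e1 h1 g1 where "P {u, x, z, y, v} (recolour (recolour (recolour c u v e1) x y h1) z v g1)"
    using wheel_weak[OF assms] by blast
  moreover have "recolour (recolour (recolour (F l f k e h g) u v e1) x y h1) z v g1 = F l f k e1 h1 g1"
    by (simp only: F_simps)
  ultimately have 1: "P {u, x, z, y, v} (F l f k e1 h1 g1)" unfolding cF by simp
  obtain f2 h2 g2 where "P {u, x, v, y, z} (recolour (recolour (recolour c u z f2) x y h2) v z g2)"
    using swapped.wheel_weak[OF *(2,1,3,4) assms(6,5)] by blast
  moreover have "recolour (recolour (recolour (F l f k e h g) u z f2) x y h2) z v g2 = F l f2 k e h2 g2"
    by (simp only: F_simps)
  ultimately have 2: "P {u, x, z, y, v} (F l f2 k e h2 g2)"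
    unfolding cF recolour_commute[of _ v z] by (simp add: insert_commute)
  \<comment> \<open>Without \<open>u\<close> the spokes are irrelevant; two copies of
    \<open>y\<close> carry the colours \<open>h1\<close> and \<open>h2\<close> of
    \<open>xy\<close>.\<close>
  obtain g3 where 3: "\<And>i. P {z, v, x, y} (F l f k e (if i then h2 else h1) g3)"
  proof -
    let ?d = "\<lambda>(i::bool) (j::bool). F l f k e (if i then h2 else h1) g"
    have a: "P (insert z {x, y}) (?d i j)" "P (insert v {x, y}) (?d i j)" for i j
      by (cases i; simp only: if_True if_False;
        ((rule P_transfer[OF 1]; (simp add: vertex_neq; fail)) | (rule P_transfer[OF 2]; (simp add: vertex_neq; fail))))+
    have b: "?d i j s t = ?d False j s t" if "s \<noteq> y" "t \<noteq> y" for i j s t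
      by (rule F_agree) (use that in \<open>auto simp: vertex_neq doubleton_eq_iff split: if_splits\<close>)
    have c: "?d i j s t = ?d i False s t" if "s \<noteq> x" "t \<noteq> x" for i j s t
      by (rule F_agree) (use that in \<open>auto simp: vertex_neq doubleton_eq_iff split: if_splits\<close>)
    have "\<exists>e. \<forall>i j. P (insert z (insert v {x, y})) (recolour (?d i j) z v e)"
      by (rule P_amalgam_copies[where d = ?d and ?d1.0 = y and ?d2.0 = x, OF _ _ _ a b c]) (simp_all add: vertex_neq)
    then show ?thesis using that unfolding F_simps by blast
  qed
  \<comment> \<open>With \<open>zv\<close> now coloured \<open>g3\<close>, each completion gives up
    one spoke again: \<open>4\<close> keeps the original \<open>uz\<close>, and \<open>5\<close>
    keeps the original \<open>uv\<close>.\<close>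
  obtain e4 where 4: "P {u, v, x, y, z} (F l f k e4 h1 g3)"
  proof (rule P_amalgam[of u "{x, y, z}" "F l f k e h1 g3" v])
    show "P {u, x, y, z} (F l f k e h1 g3)"
      by (rule P_transfer[OF 1]; simp add: vertex_neq)
    show "P {v, x, y, z} (F l f k e h1 g3)"
      by (rule P_transfer[OF 3[of False]]; simp add: vertex_neq)
  qed (use that in \<open>simp_all add: vertex_neq F_simps\<close>)
  obtain f5 where 5: "P {u, z, x, y, v} (F l f5 k e h2 g3)"
  proof (rule P_amalgam[of u "{x, y, v}" "F l f k e h2 g3" z])
    show "P {u, x, y, v} (F l f k e h2 g3)"
      by (rule P_transfer[OF 2]; simp add: vertex_neq)
    show "P {z, x, y, v} (F l f k e h2 g3)"
      by (rule P_transfer[OF 3[of True]]; simp add: vertex_neq)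
  qed (use that in \<open>simp_all add: vertex_neq F_simps\<close>)
  obtain h6 where 6: "\<And>i. P {x, y, u, z, v} (F l (if i then f5 else f) k (if i then e else e4) h6 g3)"
  proof -
    let ?d = "\<lambda>(i::bool) (j::bool). F l (if i then f5 else f) k (if i then e else e4) h g3"
    have a: "P (insert x {u, z, v}) (?d i j)" "P (insert y {u, z, v}) (?d i j)" for i j
      by (cases i; simp only: if_True if_False;
        ((rule P_transfer[OF 4]; (simp add: vertex_neq; fail)) | (rule P_transfer[OF 5]; (simp add: vertex_neq; fail))))+
    have b: "?d i j s t = ?d False j s t" if "s \<noteq> u" "t \<noteq> u" for i j s t
      by (rule F_agree) (use that in \<open>auto simp: vertex_neq doubleton_eq_iff split: if_splits\<close>)
    have c: "?d i j s t = ?d i False s t" if "s \<noteq> z" "t \<noteq> z" for i j s t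
      by (rule F_agree) (use that in \<open>auto simp: vertex_neq doubleton_eq_iff split: if_splits\<close>)
    have "\<exists>e. \<forall>i j. P (insert x (insert y {u, z, v})) (recolour (?d i j) x y e)"
      by (rule P_amalgam_copies[where d = ?d and ?d1.0 = u and ?d2.0 = z, OF _ _ _ a b c]) (simp_all add: vertex_neq)
    then show ?thesis using that unfolding F_simps by blast
  qed
  obtain g7 where 7: "P {z, v, u, x, y} (F l f k e h6 g7)"
  proof (rule P_amalgam[of z "{u, x, y}" "F l f k e h6 g" v])
    show "P {z, u, x, y} (F l f k e h6 g)"
      by (rule P_transfer[OF 6[of False]]; simp add: vertex_neq)
    show "P {v, u, x, y} (F l f k e h6 g)"
      by (rule P_transfer[OF 6[of True]]; simp add: vertex_neq)
  qed (use that in \<open>simp_all add: vertex_neq F_simps\<close>)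
  have "recolour (recolour (F l f k e h g) x y h6) z v g7 = F l f k e h6 g7"
    by (simp only: F_simps)
  then show ?thesis
    using 7 that[of h6 g7] unfolding cF by (simp add: insert_commute)
qed

end

context generic_homogeneous
begin

text \<open>
  Over a set \<open>R\<close>, the faces \<open>xz\<close>, \<open>zy\<close>, \<open>yv\<close>, \<open>vx\<close> can be completed simultaneously as soon as this is
  possible without \<open>R\<close>. The vertices of \<open>R\<close> are added one at a time, each as the hub of a wheel.
\<close>

lemma realizes_square:
  assumes "finite R" "distinct [x, z, y, v]" "{x, z, y, v} \<inter> R = {}" "\<And>a b. c a b = c b a"
    and "realizes G p (insert x (insert z R)) c" "realizes G p (insert z (insert y R)) c"
    and "realizes G p (insert y (insert v R)) c" "realizes G p (insert v (insert x R)) c"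
    and "realizes G p {x, z, y, v} (recolour (recolour c x y h0) z v g0)"
  shows "\<exists>h g. realizes G p ({x, z, y, v} \<union> R) (recolour (recolour c x y h) z v g)"
  using assms
proof (induction R rule: finite_induct)
  case empty
  then show ?case by auto
next
  case (insert u R)
  have faces: "realizes G p (insert a (insert b (insert u R))) c \<Longrightarrow> realizes G p (insert a (insert b R)) c" for a b
    by (erule realizes_subset) auto
  have "\<exists>h g. realizes G p ({x, z, y, v} \<union> R) (recolour (recolour c x y h) z v g)"
    by (rule insert.IH) (use insert.prems faces in auto)
  then obtain h g where hg: "realizes G p ({x, z, y, v} \<union> R) (recolour (recolour c x y h) z v g)" by blast
  \<comment> \<open>With the colour \<open>h\<close> of \<open>xy\<close> taken from the completion
    over \<open>R\<close>, the triangles \<open>xyz\<close> and \<open>xyv\<close> required by the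
    wheel are realized over \<open>R\<close>.\<close>
  define d where "d = recolour c x y h"
  have d_sym: "d a b = d b a" for a b
    using insert.prems(3) unfolding d_def recolour_def by (simp add: insert_commute)
  interpret wheel L G p R d u x z y v
    using insert.hyps insert.prems(1,2) d_sym by unfold_locales auto
  have sub: "P S d" if "realizes G p T c" "S \<union> R \<subseteq> T" "\<not> {x, y} \<subseteq> S \<union> R" for S T
    unfolding P_def using that(1,2)
    by (rule realizes_cong) (use that(3) in \<open>auto simp: d_def recolour_def doubleton_eq_iff\<close>)
  have sub': "P S d" if "S \<subseteq> {x, z, y, v}" "\<not> {z, v} \<subseteq> S" for S
    unfolding P_def
    by (rule realizes_cong[OF hg]) (use that vertex_neq in \<open>auto simp: d_def recolour_def doubleton_eq_iff\<close>)
  have "\<exists>h' g'. P {u, x, z, y, v} (recolour (recolour d x y h') z v g')"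
  proof (rule wheel_realized)
    show "P {u, x, z} d" by (rule sub[OF insert.prems(4)]) (use vertex_neq in auto)
    show "P {u, z, y} d" by (rule sub[OF insert.prems(5)]) (use vertex_neq in auto)
    show "P {u, y, v} d" by (rule sub[OF insert.prems(6)]) (use vertex_neq in auto)
    show "P {u, v, x} d" by (rule sub[OF insert.prems(7)]) (use vertex_neq in auto)
    show "P {x, y, z} d" "P {x, y, v} d" using sub' vertex_neq by auto
  qed blast
  moreover have "recolour d x y h' = recolour c x y h'" for h'
    unfolding d_def recolour_def by (intro ext) auto
  moreover have "{u, x, z, y, v} \<union> R = {x, z, y, v} \<union> insert u R" by auto
  ultimately show ?case unfolding P_def by simp
qed

end

section \<open>Gluing the members of a cover set\<close>

context generic_homogeneous
begin

text \<open>Colours between blocks are chosen pair by pair. A new vertex \<open>w\<close> is first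
  placed with the members of its own block, then joined to the other vertices one at a time by
  completing a square with poles \<open>x\<close>, \<open>y\<close>.\<close>

lemma realizes_blocks:
  assumes "finite M" "x \<notin> M" "y \<notin> M" "x \<noteq> y" and c_sym: "\<And>a b. c a b = c b a"
    and poles: "realizes G p {x} c" "realizes G p {y} c"
    and blocks: "\<And>m. m \<in> M \<Longrightarrow> realizes G p (insert x {n \<in> M. bl n = bl m}) c"
      "\<And>m. m \<in> M \<Longrightarrow> realizes G p (insert y {n \<in> M. bl n = bl m}) c"
    and squares: "\<And>m n. m \<in> M \<Longrightarrow> n \<in> M \<Longrightarrow> bl m \<noteq> bl n \<Longrightarrow>
      \<exists>h g. realizes G p {x, m, y, n} (recolour (recolour c x y h) m n g)"
  obtains d where "realizes G p (insert x (insert y M)) d" "\<And>a b. d a b = d b a"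
    "\<And>a b. {a, b} \<noteq> {x, y} \<Longrightarrow> {a, b} \<subseteq> M \<longrightarrow> bl a = bl b \<Longrightarrow> d a b = c a b"
proof -
  \<comment> \<open>Only pairs inside \<open>M\<close> from different blocks may be recoloured;
    pairs containing a pole keep their colour.\<close>
  define agrees where "agrees d \<longleftrightarrow> (\<forall>a b. d a b = d b a) \<and>
    (\<forall>a b. ({a, b} \<subseteq> M \<longrightarrow> bl a = bl b) \<longrightarrow> d a b = c a b)" for d
  have "\<exists>d. agrees d \<and> realizes G p (insert x N) d \<and> realizes G p (insert y N) d"
    if "finite N" "N \<subseteq> M" for N
    using that
  proof (induction N rule: finite_induct)
    case empty
    then show ?case using poles c_sym unfolding agrees_def by blast
  next
    case (insert w N)
    then obtain d where d: "agrees d" "realizes G p (insert x N) d" "realizes G p (insert y N) d" by auto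
    have w: "w \<in> M" "w \<notin> N" "N \<subseteq> M" using insert by auto
    define Nw where "Nw = {n \<in> N. bl n = bl w}"
    have "\<exists>d'. agrees d' \<and> (\<forall>a b. w \<notin> {a, b} \<longrightarrow> d' a b = d a b) \<and>
        realizes G p (insert x (insert w (Nw \<union> K))) d' \<and> realizes G p (insert y (insert w (Nw \<union> K))) d'"
      if "finite K" "K \<subseteq> N - Nw" for K
      using that
    proof (induction K rule: finite_induct)
      case empty
      have "realizes G p (insert a (insert w Nw)) d"
        if "realizes G p (insert a {n \<in> M. bl n = bl w}) c" "a \<notin> M" for a
        using that(1)
        by (rule realizes_cong) (use w d(1) that(2) in \<open>auto simp: Nw_def agrees_def\<close>)
      then show ?case using d(1) blocks[OF w(1)] assms(2,3) by auto
    next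
      case (insert n K)
      then obtain d' where d': "agrees d'" "\<And>a b. w \<notin> {a, b} \<Longrightarrow> d' a b = d a b"
        "realizes G p (insert x (insert w (Nw \<union> K))) d'" "realizes G p (insert y (insert w (Nw \<union> K))) d'"
        by auto
      have n: "n \<in> N" "n \<in> M" "bl n \<noteq> bl w" "n \<noteq> w" "n \<notin> Nw \<union> K"
        using insert w unfolding Nw_def by auto
      have R: "finite (Nw \<union> K)" "Nw \<union> K \<subseteq> N"
        using insert \<open>finite N\<close> unfolding Nw_def by auto
      have old: "realizes G p V d'" if "realizes G p (insert a N) d" "V \<subseteq> insert a N" "a \<notin> M" for a V
      proof (rule realizes_cong[OF that(1,2)])
        have "w \<notin> V" using that(2,3) w by auto
        then show "d s t = d' s t" if "s \<in> V" "t \<in> V" for s t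
          using d'(2)[of s t] that by fastforce
      qed
      obtain h0 g0 where hg0: "realizes G p {x, w, y, n} (recolour (recolour c x y h0) w n g0)"
        using squares[OF w(1) n(2)] n(3) by auto
      \<comment> \<open>The sides at \<open>w\<close> come from the inner induction and the sides at
        \<open>n\<close> from the outer one; \<open>squares\<close> completes the bare
        cycle.\<close>
      have "\<exists>h g. realizes G p ({x, w, y, n} \<union> (Nw \<union> K)) (recolour (recolour d' x y h) w n g)"
      proof (rule realizes_square)
        show "distinct [x, w, y, n]" "{x, w, y, n} \<inter> (Nw \<union> K) = {}"
          using assms(2-4) w n R by auto
        show "d' a b = d' b a" for a b using d'(1) unfolding agrees_def by blast
        show "realizes G p (insert x (insert w (Nw \<union> K))) d'" by (rule d')
        show "realizes G p (insert w (insert y (Nw \<union> K))) d'" using d'(4) by (simp add: insert_commute)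
        show "realizes G p (insert y (insert n (Nw \<union> K))) d'"
          by (rule old[OF d(3)]) (use n R assms(3) in auto)
        show "realizes G p (insert n (insert x (Nw \<union> K))) d'"
          by (rule old[OF d(2)]) (use n R assms(2) in auto)
        show "realizes G p {x, w, y, n} (recolour (recolour d' x y h0) w n g0)"
          using hg0
        proof (rule realizes_cong)
          show "recolour (recolour c x y h0) w n g0 a b = recolour (recolour d' x y h0) w n g0 a b"
            if ab: "a \<in> {x, w, y, n}" "b \<in> {x, w, y, n}" for a b
          proof (cases "{a, b} = {w, n}")
            case False
            then have "{a, b} \<subseteq> M \<longrightarrow> bl a = bl b"
              using ab assms(2,3) by (auto simp: doubleton_eq_iff)
            then show ?thesis using d'(1) unfolding agrees_def recolour_def by auto
          qed (simp add: recolour_def)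
        qed simp
      qed (rule R)
      then obtain h g where hg: "realizes G p ({x, w, y, n} \<union> (Nw \<union> K)) (recolour (recolour d' x y h) w n g)"
        by blast
      \<comment> \<open>Only the colour of \<open>wn\<close> is kept. That of \<open>xy\<close> is
        chosen once at the end, by amalgamating the poles over all of \<open>M\<close>.\<close>
      define d'' where "d'' = recolour d' w n g"
      have "agrees d''"
        using d'(1) w n unfolding agrees_def d''_def recolour_def
        by (auto simp: doubleton_eq_iff insert_commute)
      moreover have "\<forall>a b. w \<notin> {a, b} \<longrightarrow> d'' a b = d a b"
        using d'(2) unfolding d''_def recolour_def by (auto simp: doubleton_eq_iff)
      moreover have "realizes G p (insert a (insert w (Nw \<union> insert n K))) d''" if "a = x \<or> a = y" for a
        using hg
        by (rule realizes_cong)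
          (use that w n R assms(2-4) in \<open>auto simp: d''_def recolour_def doubleton_eq_iff\<close>)
      ultimately show ?case by blast
    qed
    from this[of "N - Nw"] obtain d' where "agrees d'"
      "realizes G p (insert x (insert w (Nw \<union> (N - Nw)))) d'" "realizes G p (insert y (insert w (Nw \<union> (N - Nw)))) d'"
      using insert.hyps(1) by auto
    moreover have "Nw \<union> (N - Nw) = N" unfolding Nw_def by auto
    ultimately show ?case by auto
  qed
  then obtain d where d: "agrees d" "realizes G p (insert x M) d" "realizes G p (insert y M) d"
    using assms(1) by blast
  obtain e where e: "realizes G p (insert x (insert y M)) (recolour d x y e)"
    using realizes_amalgam[OF assms(1-4) d(2,3)] by blast
  show ?thesis
  proof (rule that[OF e])
    show "recolour d x y e a b = recolour d x y e b a" for a b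
      using d(1) unfolding agrees_def recolour_def by (auto simp: insert_commute)
    show "recolour d x y e a b = c a b" if "{a, b} \<noteq> {x, y}" "{a, b} \<subseteq> M \<longrightarrow> bl a = bl b" for a b
      using d(1) that unfolding agrees_def recolour_def by auto
  qed
qed

lemma realizes_pair:
  assumes "p a < nparts L" "p b < nparts L" "p a \<noteq> p b" "c a b = c b a" "c a b \<in> colours L (p a) (p b)"
  shows "realizes G p {a, b} c"
proof -
  have inf: "infinite (part_set G (p a))" using generic assms(1) unfolding generic_def by blast
  then obtain s where s: "s \<in> part_set G (p a)" by (metis finite.emptyI ex_in_conv)
  have "finite U \<and> U \<subseteq> part_set G (p a) \<and> f ` U \<subseteq> colours L (p a) (p b) \<longrightarrow>
      (\<exists>t\<in>part_set G (p b). \<forall>u\<in>U. col G t u = f u)" for U f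
    using generic assms(1-3) unfolding generic_def by simp
  from this[of "{s}" "\<lambda>_. c a b"] obtain t where t: "t \<in> part_set G (p b)" "col G t s = c a b"
    using s assms(5) by auto
  have "col G s t = col G t s"
    using lgraph s t(1) assms(3) unfolding is_lgraph_def part_set_def by auto
  then show ?thesis
    unfolding realizes_iff using s t assms(3,4)
    by (intro exI[of _ "\<lambda>x. if x = a then s else t"]) (auto simp: part_set_def inj_on_def)
qed

end

section \<open>Omission sets from two incompatible triangles\<close>

definition with_edge :: "('w, 'c) lgraph \<Rightarrow> 'w \<Rightarrow> 'w \<Rightarrow> 'w \<Rightarrow> 'c \<Rightarrow> ('w, 'c) lgraph" where
  "with_edge A x y z e = \<lparr>verts = {x, y, z}, part = part A, col = recolour (col A) x y e\<rparr>"

lemma edge_col_eq: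
  assumes "monic L A" "x \<in> part_set A i" "y \<in> part_set A j"
  shows "edge_col A i j = col A x y"
proof -
  have "(THE x. x \<in> part_set A i) = x" "(THE x. x \<in> part_set A j) = y"
    using assms unfolding monic_def by (blast intro: the_equality)+
  then show ?thesis unfolding edge_col_def by simp
qed

lemma with_edge_triangle:
  assumes A: "is_lgraph L A" and xyz: "x \<in> part_set A i" "y \<in> part_set A j" "z \<in> part_set A k"
    and ijk: "distinct [i, j, k]" and e: "e \<in> colours L i j" and L: "is_language L"
  shows "is_lgraph L (with_edge A x y z e)" "monic L (with_edge A x y z e)"
    and "part_set (with_edge A x y z e) i = {x}" "part_set (with_edge A x y z e) j = {y}"
    and "part_set (with_edge A x y z e) k = {z}" "triangle L i j k (with_edge A x y z e)"
    and "edge_col (with_edge A x y z e) i j = e"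
    and "edge_col (with_edge A x y z e) i k = col A x z"
    and "edge_col (with_edge A x y z e) j k = col A y z"
proof -
  let ?T = "with_edge A x y z e"
  have v: "x \<in> verts A" "y \<in> verts A" "z \<in> verts A" "part A x = i" "part A y = j" "part A z = k"
    using xyz unfolding part_set_def by auto
  have ne: "x \<noteq> y" "x \<noteq> z" "y \<noteq> z" using v ijk by auto
  have n: "i < nparts L" "j < nparts L" using A v unfolding is_lgraph_def by auto
  have e': "e \<in> colours L j i" using L n e ijk unfolding is_language_def by auto
  show 1: "is_lgraph L ?T"
  proof -
    have "recolour (col A) x y e a b = recolour (col A) x y e b a \<and>
        recolour (col A) x y e a b \<in> colours L (part A a) (part A b)"
      if "a \<in> {x, y, z}" "b \<in> {x, y, z}" "part A a \<noteq> part A b" for a b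
    proof (cases "{a, b} = {x, y}")
      case True
      then show ?thesis using e e' v by (auto simp: recolour_def doubleton_eq_iff)
    next
      case False
      then have "recolour (col A) x y e a b = col A a b" "recolour (col A) x y e b a = col A b a"
        by (auto simp: recolour_def insert_commute)
      moreover have "a \<in> verts A" "b \<in> verts A" using that v by auto
      ultimately show ?thesis using A that(3) unfolding is_lgraph_def by metis
    qed
    then show ?thesis using A v unfolding is_lgraph_def with_edge_def by auto
  qed
  show p: "part_set ?T i = {x}" "part_set ?T j = {y}" "part_set ?T k = {z}"
    using v ijk unfolding part_set_def with_edge_def by auto
  have q: "part_set ?T l = {}" if "l \<notin> {i, j, k}" for l
    using v that unfolding part_set_def with_edge_def by auto
  show 2: "monic L ?T"
    using 1 v ijk unfolding monic_def part_set_def with_edge_def by auto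
  show "triangle L i j k ?T"
    using 1 p q unfolding triangle_def by auto
  have "edge_col ?T i j = col ?T x y" "edge_col ?T i k = col ?T x z" "edge_col ?T j k = col ?T y z"
    using p by (auto intro: edge_col_eq[OF 2])
  then show "edge_col ?T i j = e" "edge_col ?T i k = col A x z" "edge_col ?T j k = col A y z"
    using ne unfolding with_edge_def recolour_def by (auto simp: doubleton_eq_iff)
qed

context generic_homogeneous
begin

text \<open>A proper subset of a triangle lies in an edge, and genericity realizes every edge, so an
  omitted triangle is minimally omitted.\<close>

lemma with_edge_min_omitted:
  assumes A: "is_lgraph L A" and xyz: "x \<in> part_set A i" "y \<in> part_set A j" "z \<in> part_set A k"
    and ijk: "distinct [i, j, k]" and e: "e \<in> colours L i j" and L: "is_language L"
    and om: "\<not> realizes G (part A) {x, y, z} (recolour (col A) x y e)"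
  shows "with_edge A x y z e \<in> min_omitted L G"
proof -
  let ?T = "with_edge A x y z e"
  have T: "is_lgraph L ?T" by (rule with_edge_triangle[OF assms(1-7)])
  have v: "x \<in> verts A" "y \<in> verts A" "z \<in> verts A" "part A x = i" "part A y = j" "part A z = k"
    using xyz unfolding part_set_def by auto
  have pair: "realizes G (part A) {a, b} (recolour (col A) x y e)"
    if "{a, b} \<subseteq> {x, y, z}" "part A a \<noteq> part A b" for a b
    by (rule realizes_pair) (use T that in \<open>auto simp: with_edge_def is_lgraph_def\<close>)
  have "realized G (induced ?T U)" if U: "U \<subset> {x, y, z}" for U
  proof -
    have "U \<subseteq> {x, y} \<or> U \<subseteq> {x, z} \<or> U \<subseteq> {y, z}" using U by blast
    then have "realizes G (part A) U (recolour (col A) x y e)"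
      using pair[of x y] pair[of x z] pair[of y z] realizes_subset ijk v by fastforce
    then show ?thesis unfolding realizes_def induced_def with_edge_def by simp
  qed
  then show ?thesis
    using T om unfolding min_omitted_def by (auto simp: with_edge_def realizes_def)
qed

text \<open>If no colour of the edge between parts \<open>i\<close> and \<open>j\<close> completes
  both triangles, then each colour gives an omitted triangle of one of the two shapes, and these
  triangles form the cover set.\<close>

lemma omission_set_exists:
  fixes A A' :: "('w, 'c) lgraph"
  assumes L: "is_language L" and A: "is_lgraph L A" and A': "is_lgraph L A'"
    and xyz: "x \<in> part_set A i" "y \<in> part_set A j" "z \<in> part_set A k"
    and xyz': "x' \<in> part_set A' i" "y' \<in> part_set A' j" "z' \<in> part_set A' l"
    and ijkl: "distinct [i, j, k, l]"
    and om: "\<And>e. \<not> realizes G (part A) {x, y, z} (recolour (col A) x y e) \<or>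
      \<not> realizes G (part A') {x', y', z'} (recolour (col A') x' y' e)"
  shows "\<exists>S :: ('w, 'c) lgraph set. S \<subseteq> min_omitted L G \<and>
    omission_set L (Code i j k l (col A x z) (col A' x' z') (col A y z) (col A' y' z')) S"
proof -
  define S1 where "S1 = with_edge A x y z `
    {e \<in> colours L i j. \<not> realizes G (part A) {x, y, z} (recolour (col A) x y e)}"
  define S2 where "S2 = with_edge A' x' y' z' `
    {e \<in> colours L i j. \<not> realizes G (part A') {x', y', z'} (recolour (col A') x' y' e)}"
  have d: "distinct [i, j, k]" "distinct [i, j, l]" using ijkl by auto
  note T = with_edge_triangle[OF A xyz d(1) _ L] and T' = with_edge_triangle[OF A' xyz' d(2) _ L]
  have sub: "S1 \<union> S2 \<subseteq> min_omitted L G"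
    using with_edge_min_omitted[OF A xyz d(1) _ L] with_edge_min_omitted[OF A' xyz' d(2) _ L]
    unfolding S1_def S2_def by auto
  have col: "col B a b \<in> colours L r s" "r < nparts L" "s < nparts L"
    if "is_lgraph L B" "a \<in> part_set B r" "b \<in> part_set B s" "r \<noteq> s" for B :: "('w, 'c) lgraph" and a b r s
    using that unfolding is_lgraph_def part_set_def by auto
  have S1: "monic L B" "triangle L i j k B" "\<not> triangle L i j l B" "edge_col B i k = col A x z"
    "edge_col B j k = col A y z" if "B \<in> S1" for B
  proof -
    obtain e where e: "e \<in> colours L i j" "B = with_edge A x y z e" using \<open>B \<in> S1\<close> unfolding S1_def by auto
    show "monic L B" "triangle L i j k B" "edge_col B i k = col A x z" "edge_col B j k = col A y z"
      unfolding e(2) by (rule T[OF e(1)])+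
    then show "\<not> triangle L i j l B" using ijkl unfolding triangle_def by fastforce
  qed
  have S2: "monic L B" "triangle L i j l B" "\<not> triangle L i j k B" "edge_col B i l = col A' x' z'"
    "edge_col B j l = col A' y' z'" if "B \<in> S2" for B
  proof -
    obtain e where e: "e \<in> colours L i j" "B = with_edge A' x' y' z' e" using \<open>B \<in> S2\<close> unfolding S2_def by auto
    show "monic L B" "triangle L i j l B" "edge_col B i l = col A' x' z'" "edge_col B j l = col A' y' z'"
      unfolding e(2) by (rule T'[OF e(1)])+
    then show "\<not> triangle L i j k B" using ijkl unfolding triangle_def by fastforce
  qed
  have "cover_set L i j (S1 \<union> S2)"
    unfolding cover_set_def
  proof (intro conjI ballI)
    show "monic L B" if "B \<in> S1 \<union> S2" for B using that S1(1) S2(1) by auto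
    fix e assume e: "e \<in> colours L i j"
    have 1: "has_parts (with_edge A x y z e) {i, j}" "has_parts (with_edge A' x' y' z' e) {i, j}"
      using T(3,4)[OF e] T'(3,4)[OF e] unfolding has_parts_def by auto
    show "\<exists>B\<in>S1 \<union> S2. has_parts B {i, j} \<and> edge_col B i j = e"
      using om[of e] e 1 T(7)[OF e] T'(7)[OF e] unfolding S1_def S2_def by auto
  qed
  then have "omission_set L (Code i j k l (col A x z) (col A' x' z') (col A y z) (col A' y' z')) (S1 \<union> S2)"
    using S1 S2 ijkl col[OF A xyz(1,3)] col[OF A xyz(2,3)] col[OF A' xyz'(1,3)] col[OF A' xyz'(2,3)]
    by auto
  then show ?thesis using sub by blast
qed

end

section \<open>The contradiction from the glued cover set\<close>

theorem theorem6p1: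
  fixes L :: "'c language"
    and G :: "('v, 'c) lgraph"
    and \<A> :: "('w, 'c) lgraph set"
    and i j :: nat
  assumes "is_language L"
    and "is_lgraph L G"
    and "homogeneous G"
    and "generic L G"
    and "i < nparts L" and "j < nparts L" and "i \<noteq> j"
    and "cover_set L i j \<A>"
    and "\<A> \<subseteq> min_omitted L G"
  shows "\<exists>k \<in> {0..<nparts L} - {i, j}. \<exists>l \<in> {0..<nparts L} - {i, j}. k \<noteq> l \<and>
    (\<exists>cik cil cjk cjl. \<exists>S :: ('w, 'c) lgraph set.
       omission_set L (Code i j k l cik cil cjk cjl) S \<and>
       S \<subseteq> min_omitted L G \<and>
       code_based_on (Code i j k l cik cil cjk cjl) \<A>)"
proof (rule ccontr)
  assume neg: "\<not> ?thesis"
  interpret generic_homogeneous L G using assms by unfold_locales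
  define Cs where "Cs = colours L i j"
  have Cs: "finite Cs" "Cs \<noteq> {}" using assms(1,5-7) unfolding is_language_def Cs_def by auto
  have "\<forall>e\<in>Cs. \<exists>A\<in>\<A>. has_parts A {i, j} \<and> edge_col A i j = e"
    using assms(8) unfolding cover_set_def Cs_def by blast
  then obtain A where A: "\<And>e. e \<in> Cs \<Longrightarrow> A e \<in> \<A> \<and> has_parts (A e) {i, j} \<and> edge_col (A e) i j = e"
    by metis
  have "\<forall>e\<in>Cs. \<exists>x y. x \<in> part_set (A e) i \<and> y \<in> part_set (A e) j"
    using A unfolding has_parts_def by blast
  then obtain a b where ab: "\<And>e. e \<in> Cs \<Longrightarrow> a e \<in> part_set (A e) i \<and> b e \<in> part_set (A e) j"
    by metis
  have monic: "monic L (A e)" if "e \<in> Cs" for e using A[OF that] assms(8) unfolding cover_set_def by blast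
  have lg: "is_lgraph L (A e)" if "e \<in> Cs" for e using monic[OF that] unfolding monic_def by blast
  have abv: "a e \<in> verts (A e)" "b e \<in> verts (A e)" "part (A e) (a e) = i" "part (A e) (b e) = j" "a e \<noteq> b e"
    if "e \<in> Cs" for e using ab[OF that] assms(7) unfolding part_set_def by auto
  have col_sym: "col (A e) s t = col (A e) t s"
    if "e \<in> Cs" "s \<in> verts (A e)" "t \<in> verts (A e)" "part (A e) s \<noteq> part (A e) t" for e s t
    using lg[OF that(1)] that unfolding is_lgraph_def by auto
  \<comment> \<open>\<open>col\<close> is symmetric only between different parts, while
    \<open>realizes_blocks\<close> asks for total symmetry; \<open>sc\<close> agrees with
    \<open>col\<close> wherever it has meaning.\<close>
  define sc where "sc e s t = (if part (A e) s < part (A e) t then col (A e) s t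
    else if part (A e) t < part (A e) s then col (A e) t s else undefined)" for e s t
  have sc_sym: "sc e s t = sc e t s" for e s t unfolding sc_def by auto
  have sc: "sc e s t = col (A e) s t"
    if "e \<in> Cs" "s \<in> verts (A e)" "t \<in> verts (A e)" "part (A e) s \<noteq> part (A e) t" for e s t
    using col_sym[OF that] that(4) unfolding sc_def by auto

  \<comment> \<open>\<open>X\<close> and \<open>Y\<close> are the poles with which all
    \<open>a e\<close> and all \<open>b e\<close> are identified; in \<open>M\<close> the tag
    \<open>e\<close> keeps the blocks disjoint.\<close>
  define X Y where XY: "X = (Inr False :: ('w \<times> 'c) + bool)" "Y = (Inr True :: ('w \<times> 'c) + bool)"
  define M :: "(('w \<times> 'c) + bool) set" where "M = Inl ` (\<Union>e\<in>Cs. (verts (A e) - {a e, b e}) \<times> {e})"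
  define p where "p = case_sum (\<lambda>(w, e). part (A e) w) (\<lambda>t. if t then j else i)"
  define bl where "bl u = snd (projl u)" for u :: "('w \<times> 'c) + bool"
  define pole where "pole t e = (if t then b e else a e)" for t e
  \<comment> \<open>Pairs from different blocks and the pair of poles are left
    \<open>undefined\<close>: these are the colours to be chosen.\<close>
  define c where "c u v = (case (u, v) of
      (Inl (w, e), Inl (w', e')) \<Rightarrow> if e = e' then sc e w w' else undefined
    | (Inl (w, e), Inr t) \<Rightarrow> sc e w (pole t e)
    | (Inr t, Inl (w, e)) \<Rightarrow> sc e w (pole t e)
    | _ \<Rightarrow> undefined)" for u v :: "('w \<times> 'c) + bool"
  have c_sym: "c u v = c v u" for u v
    unfolding c_def by (auto split: sum.splits prod.splits simp: sc_sym)
  have M: "finite M" "X \<notin> M" "Y \<notin> M" "X \<noteq> Y"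
    using Cs(1) monic unfolding M_def XY monic_def by auto
  have M_iff: "Inl (w, e) \<in> M \<longleftrightarrow> e \<in> Cs \<and> w \<in> verts (A e) \<and> w \<noteq> a e \<and> w \<noteq> b e" for w e
    unfolding M_def by auto
  have M_parts: "part (A e) w \<notin> {i, j}" if "Inl (w, e) \<in> M" for w e
  proof -
    have "w = t" if "t \<in> part_set (A e) r" "part (A e) w = r" for t r
      using monic[of e] that \<open>Inl (w, e) \<in> M\<close> unfolding monic_def M_iff part_set_def by blast
    then show ?thesis using ab[of e] that unfolding M_iff by blast
  qed
  define block where "block e = {n \<in> M. bl n = e}" for e
  \<comment> \<open>A block with one pole is a copy of \<open>A e\<close> without the other pole, a
    proper induced subgraph of a minimally omitted graph.\<close>
  have block_realized: "realizes G p (insert (Inr t) (block e)) c" if e: "e \<in> Cs" for t e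
  proof -
    define \<phi> where "\<phi> u = (case u of Inl (w, _) \<Rightarrow> w | Inr t \<Rightarrow> pole t e)" for u :: "('w \<times> 'c) + bool"
    have "realized G (induced (A e) (verts (A e) - {pole (\<not> t) e}))"
    proof -
      have "pole (\<not> t) e \<in> verts (A e)" using abv[OF e] unfolding pole_def by auto
      then have "verts (A e) - {pole (\<not> t) e} \<subset> verts (A e)" by blast
      then show ?thesis using A[OF e] assms(9) unfolding min_omitted_def by blast
    qed
    then have "realizes G (part (A e)) (verts (A e) - {pole (\<not> t) e}) (col (A e))"
      unfolding realized_induced .
    then show ?thesis
    proof (rule realizes_pullback)
      have pole: "pole t e \<in> verts (A e)" "pole t e \<noteq> pole (\<not> t) e" "part (A e) (pole t e) = p (Inr t)"
        using abv[OF e] unfolding pole_def p_def by (cases t; simp)+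
      have u: "u = Inr t \<or> (\<exists>w. u = Inl (w, e) \<and> Inl (w, e) \<in> M)" if "u \<in> insert (Inr t) (block e)" for u
        using that unfolding block_def bl_def M_def by auto
      have w: "w \<in> verts (A e)" "w \<noteq> pole s e" if "Inl (w, e) \<in> M" for w s
        using that unfolding M_iff pole_def by auto
      have \<phi>_simps: "\<phi> (Inr t) = pole t e" "\<phi> (Inl (w, e)) = w" for w
        unfolding \<phi>_def by simp_all
      have \<phi>: "\<phi> u \<in> verts (A e) - {pole (\<not> t) e}" "part (A e) (\<phi> u) = p u"
        if "u \<in> insert (Inr t) (block e)" for u
      proof -
        have "\<phi> u \<in> verts (A e) - {pole (\<not> t) e} \<and> part (A e) (\<phi> u) = p u"
          using u[OF that]
        proof (elim disjE exE conjE)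
          assume "u = Inr t"
          then show ?thesis unfolding \<open>u = Inr t\<close> \<phi>_simps using pole by blast
        next
          fix s assume s: "u = Inl (s, e)" "Inl (s, e) \<in> M"
          have "part (A e) s = p (Inl (s, e))" by (simp add: p_def)
          then show ?thesis unfolding s(1) \<phi>_simps using w[OF s(2)] by blast
        qed
        then show "\<phi> u \<in> verts (A e) - {pole (\<not> t) e}" "part (A e) (\<phi> u) = p u" by blast+
      qed
      show "\<phi> ` insert (Inr t) (block e) \<subseteq> verts (A e) - {pole (\<not> t) e}"
        using \<phi>(1) by (rule image_subsetI)
      show "part (A e) (\<phi> u) = p u" if "u \<in> insert (Inr t) (block e)" for u by (rule \<phi>[OF that])
      show "inj_on \<phi> (insert (Inr t) (block e))"
      proof (rule inj_onI)
        fix u v assume uv: "u \<in> insert (Inr t) (block e)" "v \<in> insert (Inr t) (block e)" "\<phi> u = \<phi> v"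
        then show "u = v" using u[OF uv(1)] u[OF uv(2)] w(2)[of _ t] by (elim disjE exE conjE) (fastforce simp: \<phi>_simps)+
      qed
      show "col (A e) (\<phi> u) (\<phi> v) = c u v"
        if uv: "u \<in> insert (Inr t) (block e)" "v \<in> insert (Inr t) (block e)" "p u \<noteq> p v" for u v
      proof -
        have c_simps: "c (Inl (w, e)) (Inl (w', e)) = sc e w w'" "c (Inl (w, e)) (Inr t) = sc e w (pole t e)"
          "c (Inr t) (Inl (w, e)) = sc e (pole t e) w" for w w'
          unfolding c_def using sc_sym by simp_all
        have "c u v = sc e (\<phi> u) (\<phi> v)"
          using u[OF uv(1)] u[OF uv(2)] uv(3) by (elim disjE exE conjE; simp add: \<phi>_simps c_simps)
        then show ?thesis
          using sc[OF e, of "\<phi> u" "\<phi> v"] \<phi>[OF uv(1)] \<phi>[OF uv(2)] uv(3) by simp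
      qed
    qed
  qed
  have triangle_realized: "realizes G p {X, Y, Inl (w, e)} (recolour c X Y h)"
    if m: "Inl (w, e) \<in> M" and r: "realizes G (part (A e)) {a e, b e, w} (recolour (col (A e)) (a e) (b e) h)"
    for w e h
  proof -
    have e: "e \<in> Cs" "w \<in> verts (A e)" "w \<noteq> a e" "w \<noteq> b e" using m unfolding M_iff by auto
    define \<phi> where "\<phi> u = (if u = X then a e else if u = Y then b e else w)" for u
    have w: "part (A e) w \<noteq> i" "part (A e) w \<noteq> j" using M_parts[OF m] by auto
    show ?thesis
    proof (rule realizes_pullback[OF r, of \<phi>])
      show "recolour (col (A e)) (a e) (b e) h (\<phi> u) (\<phi> v) = recolour c X Y h u v"
        if "u \<in> {X, Y, Inl (w, e)}" "v \<in> {X, Y, Inl (w, e)}" "p u \<noteq> p v" for u v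
        using that abv[OF e(1)] e w sc[OF e(1)] col_sym[OF e(1,2), of "a e"] col_sym[OF e(1,2), of "b e"]
        unfolding \<phi>_def recolour_def c_def pole_def XY p_def by (auto simp: doubleton_eq_iff)
    qed (use abv[OF e(1)] e in \<open>auto simp: \<phi>_def XY p_def inj_on_def\<close>)
  qed
  have squares: "\<exists>h g. realizes G p {X, m, Y, n} (recolour (recolour c X Y h) m n g)"
    if mn: "m \<in> M" "n \<in> M" "bl m \<noteq> bl n" for m n
  proof -
    obtain w e w' e' where we: "m = Inl (w, e)" "n = Inl (w', e')"
      using mn unfolding M_def by auto
    have ee: "e \<noteq> e'" "e \<in> Cs" "e' \<in> Cs" "w \<in> verts (A e)" "w' \<in> verts (A e')"
      using mn unfolding we bl_def M_iff by auto
    have ne: "X \<noteq> Y" "m \<noteq> n" "X \<noteq> m" "X \<noteq> n" "Y \<noteq> m" "Y \<noteq> n" using M mn we ee by auto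
    have comm: "recolour (recolour c m n g) X Y h = recolour (recolour c X Y h) m n g" for g h
      using ne unfolding recolour_def by (intro ext) (auto simp: doubleton_eq_iff)
    have edge: "realizes G p {Inr t, u} c" if "u = m \<or> u = n" for t u
      using block_realized[of "bl u" t] that mn ee we
      by (auto elim!: realizes_subset simp: block_def bl_def)
    show ?thesis
    proof (cases "p m = p n")
      case True
      \<comment> \<open>Since \<open>m\<close> and \<open>n\<close> lie in the same part,
        \<open>undefined\<close> may stand for their colour; it is the same for both poles, which
        can then be amalgamated over \<open>m\<close>, \<open>n\<close>.\<close>
      have "realizes G p {Inr t, m, n} (recolour c m n undefined)" for t
      proof -
        have "m \<notin> {Inr t}" "n \<notin> {Inr t}" unfolding we by auto
        moreover have "realizes G p (insert m {Inr t}) c" "realizes G p (insert n {Inr t}) c"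
          using edge[of m t] edge[of n t] by (simp_all add: insert_commute)
        ultimately obtain g where "realizes G p (insert m (insert n {Inr t})) (recolour c m n g)"
          using realizes_amalgam[of "{Inr t}" m n p c] ne(2) by blast
        then show ?thesis
          by (rule realizes_cong) (use True in \<open>auto simp: recolour_def doubleton_eq_iff\<close>)
      qed
      then have "realizes G p (insert X {m, n}) (recolour c m n undefined)"
        "realizes G p (insert Y {m, n}) (recolour c m n undefined)" unfolding XY by auto
      then obtain h where "realizes G p (insert X (insert Y {m, n})) (recolour (recolour c m n undefined) X Y h)"
        using realizes_amalgam[of "{m, n}" X Y p] ne by auto
      then show ?thesis unfolding comm by (metis insert_commute)
    next
      case False
      \<comment> \<open>Without a common colour \<open>h\<close> the triangles at \<open>w\<close>
        and \<open>w'\<close> would yield an omission set based on the cover set, contrary to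
        \<open>neg\<close>. With one, \<open>m\<close> and \<open>n\<close> are amalgamated over the
        poles.\<close>
      have "\<exists>h. realizes G p {X, Y, m} (recolour c X Y h) \<and> realizes G p {X, Y, n} (recolour c X Y h)"
      proof (rule ccontr)
        assume no: "\<not> ?thesis"
        define k l where kl: "k = part (A e) w" "l = part (A e') w'"
        have dist: "distinct [i, j, k, l]"
          using assms(7) False M_parts[of w e] M_parts[of w' e'] mn unfolding kl we p_def by auto
        have z: "w \<in> part_set (A e) k" "w' \<in> part_set (A e') l" using ee unfolding kl part_set_def by auto
        have om: "\<not> realizes G (part (A e)) {a e, b e, w} (recolour (col (A e)) (a e) (b e) h) \<or>
            \<not> realizes G (part (A e')) {a e', b e', w'} (recolour (col (A e')) (a e') (b e') h)" for h
          using no triangle_realized[of w e h] triangle_realized[of w' e' h] mn unfolding we by blast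
        from ab ee have ab': "a e \<in> part_set (A e) i" "b e \<in> part_set (A e) j"
          "a e' \<in> part_set (A e') i" "b e' \<in> part_set (A e') j" by blast+
        from omission_set_exists[OF assms(1) lg[OF ee(2)] lg[OF ee(3)] ab'(1,2) z(1) ab'(3,4) z(2) dist om]
        obtain S :: "('w, 'c) lgraph set" where S: "S \<subseteq> min_omitted L G"
          "omission_set L (Code i j k l (col (A e) (a e) w) (col (A e') (a e') w')
             (col (A e) (b e) w) (col (A e') (b e') w')) S"
          by (elim exE conjE)
        have "has_parts (A e) {i, j, k}" "has_parts (A e') {i, j, l}"
          using ab' z unfolding has_parts_def by auto
        moreover have "edge_col (A e) i k = col (A e) (a e) w" "edge_col (A e) j k = col (A e) (b e) w"
          "edge_col (A e') i l = col (A e') (a e') w'" "edge_col (A e') j l = col (A e') (b e') w'"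
          using edge_col_eq[OF monic[OF ee(2)] _ z(1)] edge_col_eq[OF monic[OF ee(3)] _ z(2)] ab' by blast+
        ultimately have "code_based_on (Code i j k l (col (A e) (a e) w) (col (A e') (a e') w')
             (col (A e) (b e) w) (col (A e') (b e') w')) \<A>"
          using A[OF ee(2)] A[OF ee(3)] unfolding code_based_on.simps by blast
        moreover have "k \<in> {0..<nparts L} - {i, j}" "l \<in> {0..<nparts L} - {i, j}" "k \<noteq> l"
          using S(2) dist by auto
        ultimately show False using neg S by blast
      qed
      then obtain h where "realizes G p (insert m {X, Y}) (recolour c X Y h)"
        "realizes G p (insert n {X, Y}) (recolour c X Y h)"
        by (auto simp: insert_commute)
      then obtain g where "realizes G p (insert m (insert n {X, Y})) (recolour (recolour c X Y h) m n g)"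
        using realizes_amalgam[of "{X, Y}" m n p] ne by auto
      then show ?thesis by (metis insert_commute)
    qed
  qed
  have poles: "realizes G p {X} c" "realizes G p {Y} c"
  proof -
    obtain e where "e \<in> Cs" using Cs(2) by blast
    then show "realizes G p {X} c" "realizes G p {Y} c"
      using block_realized unfolding XY by (blast intro: realizes_subset)+
  qed
  have blocks: "realizes G p (insert X {n \<in> M. bl n = bl m}) c" "realizes G p (insert Y {n \<in> M. bl n = bl m}) c"
    if "m \<in> M" for m
    using block_realized[of "bl m"] that unfolding XY block_def M_def bl_def by auto
  obtain d where d: "realizes G p (insert X (insert Y M)) d" "\<And>u v. d u v = d v u"
    "\<And>u v. {u, v} \<noteq> {X, Y} \<Longrightarrow> {u, v} \<subseteq> M \<longrightarrow> bl u = bl v \<Longrightarrow> d u v = c u v"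
    by (rule realizes_blocks[OF M c_sym poles blocks squares]) (assumption | rule that)+
  \<comment> \<open>The colour obtained for the pair of poles selects the member to be realized: the
    block \<open>e\<close> with both poles is a copy of \<open>A e\<close>.\<close>
  define e where "e = d X Y"
  have eC: "e \<in> Cs"
  proof -
    obtain f where "\<forall>x\<in>insert X (insert Y M). f x \<in> verts G \<and> part G (f x) = p x"
      "\<forall>x\<in>insert X (insert Y M). \<forall>y\<in>insert X (insert Y M). p x \<noteq> p y \<longrightarrow> col G (f x) (f y) = d x y"
      using d(1) unfolding realizes_iff by blast
    then have "f X \<in> verts G" "f Y \<in> verts G" "part G (f X) = i" "part G (f Y) = j" "col G (f X) (f Y) = e"
      using assms(7) unfolding e_def XY p_def by auto
    then show ?thesis using assms(2,7) unfolding is_lgraph_def Cs_def by auto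
  qed
  define \<phi> where "\<phi> s = (if s = a e then X else if s = b e then Y else Inl (s, e))" for s
  have "realizes G (part (A e)) (verts (A e)) (col (A e))"
  proof (rule realizes_pullback[OF d(1), of \<phi>])
    show "inj_on \<phi> (verts (A e))" unfolding \<phi>_def inj_on_def XY by auto
    show "\<phi> ` verts (A e) \<subseteq> insert X (insert Y M)" using eC unfolding \<phi>_def by (auto simp: M_iff)
    show "p (\<phi> s) = part (A e) s" for s
      using abv[OF eC] unfolding \<phi>_def p_def XY by auto
    show "d (\<phi> s) (\<phi> t) = col (A e) s t" if st: "s \<in> verts (A e)" "t \<in> verts (A e)" "part (A e) s \<noteq> part (A e) t" for s t
    proof (cases "{s, t} = {a e, b e}")
      case True
      have "col (A e) (a e) (b e) = e"
        using edge_col_eq[OF monic[OF eC]] ab[OF eC] A[OF eC] by auto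
      moreover have "col (A e) (b e) (a e) = col (A e) (a e) (b e)"
        using col_sym[OF eC, of "a e" "b e"] abv[OF eC] assms(7) by simp
      ultimately show ?thesis
        using True abv(5)[OF eC] d(2) unfolding \<phi>_def e_def by (auto simp: doubleton_eq_iff)
    next
      case False
      have "{\<phi> s, \<phi> t} \<noteq> {X, Y}" "{\<phi> s, \<phi> t} \<subseteq> M \<longrightarrow> bl (\<phi> s) = bl (\<phi> t)"
        using False M(2,3) st(3) unfolding \<phi>_def XY bl_def by (auto simp: doubleton_eq_iff)
      then have "d (\<phi> s) (\<phi> t) = c (\<phi> s) (\<phi> t)" by (rule d(3))
      also have "\<dots> = sc e s t"
        using False st(3) sc_sym unfolding \<phi>_def XY c_def pole_def by auto
      finally show ?thesis using sc[OF eC st] by simp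
    qed
  qed
  then have "realized G (induced (A e) (verts (A e)))" unfolding realized_induced .
  then have "realized G (A e)" by (simp add: induced_def)
  then show False using A[OF eC] assms(9) unfolding min_omitted_def by blast
qed

end
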